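(* Assume the framework in the context, that each $m_i$ is $\delta_i$-Ahlfors regular, that $\{\mathcal R_{\alpha,i}\}_{\alpha\in J}$ has the $\kappa$-scaling property for each $1\le i\le d$ (for some fixed $0\le\kappa<1$), and that $(\{\mathcal R_\alpha\}_{\alpha\in J},\beta)$ is a local ubiquity system for rectangles with respect to $(\rho,\mathbf a)$, where $\mathbf a=(a_1,\dots,a_d)\in(0,\infty)^d$. Then for every $\mathbf t=(t_1,\dots,t_d)\in(0,\infty)^d$, $$\dim_H W(\mathbf t)\ \ge\ s(\mathbf t).$$
   Context: Fix an integer $d\ge1$. For each $1\le i\le d$, $(X_i,|\cdot|_i)$ is a bounded locally compact metric space carrying a Borel probability measure $m_i$. The measure $m_i$ is $\delta_i$-Ahlfors regular ($\delta_i>0$) if there are constants $c,C,r_0>0$ with $c\,r^{\delta_i}\le m_i(B(x,r))\le C\,r^{\delta_i}$ for all $x\in X_i$ and $0<r\le r_0$. Put $X=\prod_{i=1}^dX_i$ with metric $|x-y|=\max_i|x_i-y_i|_i$ and measure $m=\prod_i m_i$; thus a ball in $X$ is $B(x,r)=\prod_iB(x_i,r)$. For $E\subset X_i$ and $\epsilon>0$, $\Delta(E,\epsilon)=\{y\in X_i:\operatorname{dist}(y,E)<\epsilon\}$. $J$ is an infinite countable index set and $\beta:J\to(0,\infty)$, $\alpha\mapsto\beta_\alpha$, satisfies: $\{\alpha:\beta_\alpha<M\}$ is finite for every $M>1$. $\{\ell_n\},\{u_n\}$ are increasing sequences with $\ell_n\le u_n$, $\ell_n\to\infty$, and $J_n=\{\alpha\in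 J:\ell_n\le\beta_\alpha\le u_n\}$. $\rho:(0,\infty)\to(0,\infty)$ is non-increasing with $\rho(u)\to0$ as $u\to\infty$. For each $i$, $\{\mathcal R_{\alpha,i}:\alpha\in J\}$ are subsets of $X_i$ and $\mathcal R_\alpha=\prod_i\mathcal R_{\alpha,i}$. For $\mathbf b=(b_1,\dots,b_d)\in(0,\infty)^d$ and $r>0$, $\Delta(\mathcal R_\alpha,r^{\mathbf b})=\prod_{i=1}^d\Delta(\mathcal R_{\alpha,i},r^{b_i})$. $\kappa$-scaling property ($0\le\kappa<1$): there are constants $c_2,c_3>0$ such that for every $\alpha\in J$, every $x_i\in\mathcal R_{\alpha,i}$ and every $0<\epsilon<r$ (with $r$ sufficiently small), $c_2r^{\delta_i\kappa}\epsilon^{\delta_i(1-\kappa)}\le m_i(B(x_i,r)\cap\Delta(\mathcal R_{\alpha,i},\epsilon))\le c_3r^{\delta_i\kappa}\epsilon^{\delta_i(1-\kappa)}$. Local ubiquity system for rectangles w.r.t. $(\rho,\mathbf a)$: there is $c>0$ such that for every ball $B\subset X$, $\limsup_{n\to\infty}m\big(B\cap\bigcup_{\alpha\in J_n}\Delta(\mathcal R_\alpha,\rho(u_n)^{\mathbf a})\big)\ge c\,m(B)$. For $\mathbf t\in[0,\infty)^d$: $W(\mathbf t)=\{x\in X: x\in\Delta(\mathcal R_\alpha,\rho(\beta_\alpha)^{\mathbf a+\mathbf t})\text{ for infinitely many }\alpha\in J\}$. Dimensional number: let $\mathcal A=\{a_i,\ a_i+t_i:1\le i\le d\}$. For $A\in\mathcal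 A$ let $\mathcal K_1=\{k:a_k\ge A\}$, $\mathcal K_2=\{k:a_k+t_k\le A\}\setminus\mathcal K_1$, $\mathcal K_3=\{1,\dots,d\}\setminus(\mathcal K_1\cup\mathcal K_2)$, and $$s(\mathbf t)=\min_{A\in\mathcal A}\Big\{\sum_{k\in\mathcal K_1}\delta_k+\sum_{k\in\mathcal K_2}\delta_k+\kappa\sum_{k\in\mathcal K_3}\delta_k+(1-\kappa)\frac{\sum_{k\in\mathcal K_3}a_k\delta_k-\sum_{k\in\mathcal K_2}t_k\delta_k}{A}\Big\}.$$ *)

theory Defs
  imports "HOL-Analysis.Analysis" "HOL-Probability.Probability"
begin

definition gdiam :: "('b \<Rightarrow> 'b \<Rightarrow> real) \<Rightarrow> 'b set \<Rightarrow> ennreal" where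
  "gdiam dd U = (SUP x\<in>U. SUP y\<in>U. ennreal (dd x y))"

text \<open>Contribution diam(U)^s of a set U (only used for sets of finite diameter).\<close>
definition diam_pow :: "('b \<Rightarrow> 'b \<Rightarrow> real) \<Rightarrow> real \<Rightarrow> 'b set \<Rightarrow> ennreal" where
  "diam_pow dd s U = ennreal (enn2real (gdiam dd U) powr s)"

definition hausdorff_content ::
  "('b \<Rightarrow> 'b \<Rightarrow> real) \<Rightarrow> real \<Rightarrow> real \<Rightarrow> 'b set \<Rightarrow> ennreal" where
  "hausdorff_content dd s \<eta> E =
     (INF U\<in>{U :: nat \<Rightarrow> 'b set. E \<subseteq> (\<Union>k. U k) \<and> (\<forall>k. gdiam dd (U k) \<le> ennreal \<eta>)}.
        (\<Sum>k. diam_pow dd s (U k)))"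

definition hausdorff_measure :: "('b \<Rightarrow> 'b \<Rightarrow> real) \<Rightarrow> real \<Rightarrow> 'b set \<Rightarrow> ennreal" where
  "hausdorff_measure dd s E = (SUP \<eta>\<in>{0<..}. hausdorff_content dd s \<eta> E)"

definition hausdorff_dim :: "('b \<Rightarrow> 'b \<Rightarrow> real) \<Rightarrow> 'b set \<Rightarrow> ereal" where
  "hausdorff_dim dd E = Inf (ereal ` {s. 0 \<le> s \<and> hausdorff_measure dd s E = 0})"

definition prod_dist :: "nat \<Rightarrow> (nat \<Rightarrow> 'a \<Rightarrow> 'a \<Rightarrow> real) \<Rightarrow> (nat \<Rightarrow> 'a) \<Rightarrow> (nat \<Rightarrow> 'a) \<Rightarrow> real" where
  "prod_dist d dst x y = Max ((\<lambda>i. dst i (x i) (y i)) ` {..<d})"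

definition ball_i :: "('a set) \<Rightarrow> ('a \<Rightarrow> 'a \<Rightarrow> real) \<Rightarrow> 'a \<Rightarrow> real \<Rightarrow> 'a set" where
  "ball_i Xi dsti x r = {y \<in> Xi. dsti x y < r}"

definition Delta :: "('a set) \<Rightarrow> ('a \<Rightarrow> 'a \<Rightarrow> real) \<Rightarrow> 'a set \<Rightarrow> real \<Rightarrow> 'a set" where
  "Delta Xi dsti E \<epsilon> = {y \<in> Xi. (INF z\<in>E. ereal (dsti y z)) < ereal \<epsilon>}"

definition ahlfors_regular :: "'a set \<Rightarrow> ('a \<Rightarrow> 'a \<Rightarrow> real) \<Rightarrow> 'a measure \<Rightarrow> real \<Rightarrow> bool" where
  "ahlfors_regular Xi dsti mi \<delta> \<longleftrightarrow>
     (\<exists>c C r0. c > 0 \<and> C > 0 \<and> r0 > 0 \<and>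
        (\<forall>x\<in>Xi. \<forall>r. 0 < r \<and> r \<le> r0 \<longrightarrow>
            c * r powr \<delta> \<le> measure mi (ball_i Xi dsti x r) \<and>
            measure mi (ball_i Xi dsti x r) \<le> C * r powr \<delta>))"

definition kappa_scaling ::
  "'a set \<Rightarrow> ('a \<Rightarrow> 'a \<Rightarrow> real) \<Rightarrow> 'a measure \<Rightarrow> real \<Rightarrow> 'j set \<Rightarrow> ('j \<Rightarrow> 'a set) \<Rightarrow> real \<Rightarrow> bool" where
  "kappa_scaling Xi dsti mi \<delta> J Ri \<kappa> \<longleftrightarrow>
     (\<exists>c2 c3 r0. c2 > 0 \<and> c3 > 0 \<and> r0 > 0 \<and>
        (\<forall>\<alpha>\<in>J. \<forall>x\<in>Ri \<alpha>. \<forall>\<epsilon> r. 0 < \<epsilon> \<and> \<epsilon> < r \<and> r \<le> r0 \<longrightarrow>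
            c2 * r powr (\<delta> * \<kappa>) * \<epsilon> powr (\<delta> * (1 - \<kappa>))
              \<le> measure mi (ball_i Xi dsti x r \<inter> Delta Xi dsti (Ri \<alpha>) \<epsilon>) \<and>
            measure mi (ball_i Xi dsti x r \<inter> Delta Xi dsti (Ri \<alpha>) \<epsilon>)
              \<le> c3 * r powr (\<delta> * \<kappa>) * \<epsilon> powr (\<delta> * (1 - \<kappa>))))"

definition Delta_rect ::
  "nat \<Rightarrow> (nat \<Rightarrow> 'a set) \<Rightarrow> (nat \<Rightarrow> 'a \<Rightarrow> 'a \<Rightarrow> real) \<Rightarrow> (nat \<Rightarrow> 'a set) \<Rightarrow> real \<Rightarrow> (nat \<Rightarrow> real)
     \<Rightarrow> (nat \<Rightarrow> 'a) set" where
  "Delta_rect d X dst R r b = (\<Pi>\<^sub>E i\<in>{..<d}. Delta (X i) (dst i) (R i) (r powr b i))"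

definition ball_X :: "nat \<Rightarrow> (nat \<Rightarrow> 'a set) \<Rightarrow> (nat \<Rightarrow> 'a \<Rightarrow> 'a \<Rightarrow> real) \<Rightarrow> (nat \<Rightarrow> 'a) \<Rightarrow> real
     \<Rightarrow> (nat \<Rightarrow> 'a) set" where
  "ball_X d X dst x r = (\<Pi>\<^sub>E i\<in>{..<d}. ball_i (X i) (dst i) (x i) r)"

definition J_n :: "'j set \<Rightarrow> ('j \<Rightarrow> real) \<Rightarrow> (nat \<Rightarrow> real) \<Rightarrow> (nat \<Rightarrow> real) \<Rightarrow> nat \<Rightarrow> 'j set" where
  "J_n J \<beta> l u n = {\<alpha>\<in>J. l n \<le> \<beta> \<alpha> \<and> \<beta> \<alpha> \<le> u n}"

definition local_ubiquity_rect ::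
  "nat \<Rightarrow> (nat \<Rightarrow> 'a set) \<Rightarrow> (nat \<Rightarrow> 'a \<Rightarrow> 'a \<Rightarrow> real) \<Rightarrow> (nat \<Rightarrow> 'a measure)
    \<Rightarrow> 'j set \<Rightarrow> ('j \<Rightarrow> nat \<Rightarrow> 'a set) \<Rightarrow> ('j \<Rightarrow> real) \<Rightarrow> (nat \<Rightarrow> real) \<Rightarrow> (nat \<Rightarrow> real)
    \<Rightarrow> (real \<Rightarrow> real) \<Rightarrow> (nat \<Rightarrow> real) \<Rightarrow> bool" where
  "local_ubiquity_rect d X dst m J R \<beta> l u \<rho> a \<longleftrightarrow>
     (\<exists>c>0. \<forall>x\<in>(\<Pi>\<^sub>E i\<in>{..<d}. X i). \<forall>r>0.
        limsup (\<lambda>n. ereal (measure (PiM {..<d} m)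
           (ball_X d X dst x r \<inter> (\<Union>\<alpha>\<in>J_n J \<beta> l u n. Delta_rect d X dst (R \<alpha>) (\<rho> (u n)) a))))
        \<ge> ereal (c * measure (PiM {..<d} m) (ball_X d X dst x r)))"

definition W_set ::
  "nat \<Rightarrow> (nat \<Rightarrow> 'a set) \<Rightarrow> (nat \<Rightarrow> 'a \<Rightarrow> 'a \<Rightarrow> real) \<Rightarrow> 'j set \<Rightarrow> ('j \<Rightarrow> nat \<Rightarrow> 'a set)
    \<Rightarrow> ('j \<Rightarrow> real) \<Rightarrow> (real \<Rightarrow> real) \<Rightarrow> (nat \<Rightarrow> real) \<Rightarrow> (nat \<Rightarrow> real) \<Rightarrow> (nat \<Rightarrow> 'a) set" where
  "W_set d X dst J R \<beta> \<rho> a t =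
     {x \<in> (\<Pi>\<^sub>E i\<in>{..<d}. X i).
        infinite {\<alpha>\<in>J. x \<in> Delta_rect d X dst (R \<alpha>) (\<rho> (\<beta> \<alpha>)) (\<lambda>i. a i + t i)}}"

definition dim_term :: "nat \<Rightarrow> (nat \<Rightarrow> real) \<Rightarrow> real \<Rightarrow> (nat \<Rightarrow> real) \<Rightarrow> (nat \<Rightarrow> real) \<Rightarrow> real \<Rightarrow> real" where
  "dim_term d \<delta> \<kappa> a t A =
     (let K1 = {k\<in>{..<d}. a k \<ge> A};
          K2 = {k\<in>{..<d}. a k + t k \<le> A} - K1;
          K3 = {..<d} - (K1 \<union> K2)
      in (\<Sum>k\<in>K1. \<delta> k) + (\<Sum>k\<in>K2. \<delta> k) + \<kappa> * (\<Sum>k\<in>K3. \<delta> k)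
         + (1 - \<kappa>) * ((\<Sum>k\<in>K3. a k * \<delta> k) - (\<Sum>k\<in>K2. t k * \<delta> k)) / A)"

definition dim_number :: "nat \<Rightarrow> (nat \<Rightarrow> real) \<Rightarrow> real \<Rightarrow> (nat \<Rightarrow> real) \<Rightarrow> (nat \<Rightarrow> real) \<Rightarrow> real" where
  "dim_number d \<delta> \<kappa> a t =
     Min ((dim_term d \<delta> \<kappa> a t) ` ((\<lambda>i. a i) ` {..<d} \<union> (\<lambda>i. a i + t i) ` {..<d}))"

end

theory Submission
  imports Defs
begin

text \<open>
  Write \<open>r\<close> for \<open>\<rho> (u n)\<close>. Inside a ball \<open>B\<close> of radius \<open>\<xi>\<close>, ubiquity at infinitely many levels
  \<open>n\<close> provides about \<open>m B / r powr (\<Sum>i. a i * \<delta> i)\<close> disjoint boxes \<open>\<Prod>i. B (x i, r powr a i / 2)\<close>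
  centred on resonant sets. The normalised restriction of \<open>m\<close> to the union \<open>G\<close> of the traces of the
  neighbourhoods \<open>\<Delta> (R \<alpha>, r powr (a + t) / 2)\<close> in these boxes gives mass at most
  \<open>K * q powr s / m B\<close> to every ball of radius \<open>q\<close>, with \<open>K\<close> independent of \<open>B\<close> and \<open>n\<close>: for \<open>q = r powr A\<close> the
  exponent produced coordinate by coordinate is exactly the term of the dimensional number at \<open>A\<close>.

  Iterating this replacement below an exponent \<open>p < s\<close> gives measures \<open>\<nu> k\<close> on decreasing open sets
  \<open>\<Omega> k\<close> with \<open>\<nu> k (ball x q) \<le> A * q powr p\<close> uniformly in \<open>k\<close>: the mass of \<open>\<nu> k\<close> is moved by at most three
  radii \<open>\<xi>\<close>, so large balls gain a factor close to one, while on small balls the slack \<open>q powr (s - p)\<close>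
  absorbs every constant accumulated so far. No limit measure is needed: by compactness a cover of
  the limsup set by small balls already covers some \<open>\<Omega> k\<close>, so the mass bound applies to \<open>\<nu> k\<close>.
\<close>

section \<open>Mass redistribution in Ahlfors regular spaces\<close>

text \<open>The constant without uniform control is the density bound \<open>H\<close> of the
  current measure with respect to \<open>m\<close>. It is finite at every stage, because each
  measure is a finite weighted sum of restrictions of \<open>m\<close>, but it may explode along the
  iteration. This dictates the order of choices: \<open>H\<close> is known before the mesh
  \<open>\<xi>\<close> is picked, and \<open>\<xi>\<close> is then so small that the constant times
  a power of \<open>\<xi>\<close> with exponent \<open>s - p\<close> fits under the permitted value.
  For this to make sense, the local constant \<open>K\<close> must not depend on
  \<open>\<xi>\<close>. Regularity bounds the mass of a ball of radius \<open>2 * \<xi>\<close> by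
  \<open>H\<close> times a constant times \<open>\<xi> powr D\<close>, and exactly this power
  cancels the division by \<open>\<xi> powr D\<close> in the local estimate. The neighbourhoods have
  halved radii so that each new open set keeps a uniform distance from the complement of the old
  one. Closures then nest, which turns the open sets into compact ones. Mass is only required to
  exceed one half: a strict inequality survives replacing an open set by finitely many balls that
  miss a little of it.\<close>

text \<open>\<open>3 / L\<close> bounds the relative growth of the radius when a ball of radius at
  least \<open>L * \<xi>\<close> is enlarged by \<open>3 * \<xi>\<close>.\<close>

lemma ex_dilation_factor:
  fixes A A' p :: real
  assumes "0 \<le> A" "A < A'"
  obtains L where "1 < L" "A * (1 + 3 / L) powr p < A'"
proof -
  have "((\<lambda>L::real. 1 + 3 / L) \<longlongrightarrow> 1 + 0) at_top"
    by (intro tendsto_add tendsto_const tendsto_divide_0[OF tendsto_const] filterlim_at_top_imp_at_infinity filterlim_ident)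
  then have "((\<lambda>L. A * (1 + 3 / L) powr p) \<longlongrightarrow> A * (1 + 0) powr p) at_top"
    by (intro tendsto_mult tendsto_const tendsto_powr) auto
  then have "\<forall>\<^sub>F L in at_top. A * (1 + 3 / L) powr p < A'"
    using assms by (intro order_tendstoD(2)[of _ "A * (1 + 0) powr p"]) auto
  then have "\<forall>\<^sub>F L in at_top. 1 < L \<and> A * (1 + 3 / L) powr p < A'"
    using eventually_gt_at_top[of "1::real"] by eventually_elim simp
  then show ?thesis
    using that eventually_happens[of _ at_top] trivial_limit_at_top_linorder by blast
qed

lemma ex_small_powr:
  fixes B q \<epsilon> :: real
  assumes "0 < q" "0 < \<epsilon>"
  obtains x0 where "0 < x0" "\<And>x. 0 < x \<Longrightarrow> x \<le> x0 \<Longrightarrow> B * x powr q < \<epsilon>"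
proof -
  have "((\<lambda>x. B * x powr q) \<longlongrightarrow> B * 0 powr q) (at_right 0)"
    using assms by (intro tendsto_mult tendsto_const tendsto_powr' tendsto_ident_at)
      (auto simp: eventually_at_right_less eventually_at_filter)
  then have "\<forall>\<^sub>F x in at_right 0. B * x powr q < \<epsilon>"
    using assms by (intro order_tendstoD(2)[of _ "B * 0 powr q"]) auto
  then obtain b where "0 < b" "\<And>x. 0 < x \<Longrightarrow> x < b \<Longrightarrow> B * x powr q < \<epsilon>"
    by (auto simp: eventually_at_right_field)
  then show ?thesis by (intro that[of "b / 2"]) auto
qed

text \<open>A cardinality bound, supplied later by comparing volumes, takes the place of total
  boundedness: a separated set of greatest cardinality cannot be enlarged, so every point is near
  one of its members. No transitivity of \<open>near\<close> enters.\<close>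

lemma maximal_separated_subset:
  fixes near :: "'b \<Rightarrow> 'b \<Rightarrow> bool"
  assumes refl: "\<And>x. x \<in> P \<Longrightarrow> near x x"
    and sym: "\<And>x y. near x y \<Longrightarrow> near y x"
    and bound: "\<And>Z. \<lbrakk>finite Z; Z \<subseteq> P; pairwise (\<lambda>x y. \<not> near x y) Z\<rbrakk> \<Longrightarrow> card Z \<le> n"
  obtains Z where "finite Z" "Z \<subseteq> P" "pairwise (\<lambda>x y. \<not> near x y) Z"
    "\<And>x. x \<in> P \<Longrightarrow> \<exists>z\<in>Z. near x z"
proof -
  let ?S = "\<lambda>Z. finite Z \<and> Z \<subseteq> P \<and> pairwise (\<lambda>x y. \<not> near x y) Z"
  have "\<exists>Z. ?S Z \<and> (\<forall>Y. ?S Y \<longrightarrow> card Y \<le> card Z)"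
  proof (rule Lattices_Big.ex_has_greatest_nat[where k = "{}" and b = "Suc n"])
    show "\<forall>Y. ?S Y \<longrightarrow> card Y < Suc n"
      using bound by (simp add: less_Suc_eq_le)
  qed simp
  then obtain Z where Z: "?S Z" and max: "\<And>Y. ?S Y \<Longrightarrow> card Y \<le> card Z" by blast
  have "\<exists>z\<in>Z. near x z" if x: "x \<in> P" for x
  proof (rule ccontr)
    assume no: "\<not> (\<exists>z\<in>Z. near x z)"
    then have "x \<notin> Z" using refl x by blast
    moreover have "?S (insert x Z)"
      using Z no x sym by (auto simp: pairwise_insert)
    ultimately show False
      using max[of "insert x Z"] Z by simp
  qed
  with Z that show ?thesis by blast
qed

lemma card_mult_le_measure:
  assumes "finite_measure N" "finite Z" "disjoint_family_on B Z" "A \<in> sets N"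
    and "\<And>z. z \<in> Z \<Longrightarrow> B z \<in> sets N" "\<And>z. z \<in> Z \<Longrightarrow> B z \<subseteq> A"
    and "\<And>z. z \<in> Z \<Longrightarrow> c \<le> measure N (B z)"
  shows "real (card Z) * c \<le> measure N A"
proof -
  interpret finite_measure N by fact
  have "real (card Z) * c = (\<Sum>z\<in>Z. c)" by simp
  also have "\<dots> \<le> (\<Sum>z\<in>Z. measure N (B z))"
    by (intro sum_mono assms)
  also have "\<dots> = measure N (\<Union>z\<in>Z. B z)"
    by (rule finite_measure_finite_Union[symmetric]) (use assms in auto)
  also have "\<dots> \<le> measure N A"
    by (rule finite_measure_mono) (use assms in auto)
  finally show ?thesis .
qed

text \<open>Each point is assigned to the first \<open>B z\<close> containing it, in an arbitrary
  enumeration of \<open>Z\<close>.\<close>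

lemma finite_disjointed_sets:
  fixes B :: "'b \<Rightarrow> 'a set"
  assumes "finite Z" "\<And>z. z \<in> Z \<Longrightarrow> B z \<in> sets N"
  obtains Q where "\<And>z. z \<in> Z \<Longrightarrow> Q z \<in> sets N" "\<And>z. z \<in> Z \<Longrightarrow> Q z \<subseteq> B z"
    "disjoint_family_on Q Z" "(\<Union>z\<in>Z. Q z) = (\<Union>z\<in>Z. B z)"
proof -
  obtain f :: "'b \<Rightarrow> nat" where f: "inj_on f Z"
    using assms(1) by (meson finite_imp_inj_to_nat_seg)
  define Q where "Q z = B z - (\<Union>y\<in>{y\<in>Z. f y < f z}. B y)" for z
  have "disjoint_family_on Q Z"
    unfolding disjoint_family_on_def
  proof (intro ballI impI)
    fix y z assume "y \<in> Z" "z \<in> Z" "y \<noteq> z"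
    moreover from this f have "f y < f z \<or> f z < f y"
      by (meson inj_onD linorder_neqE_nat)
    ultimately show "Q y \<inter> Q z = {}" unfolding Q_def by blast
  qed
  moreover have "x \<in> (\<Union>z\<in>Z. Q z)" if x: "z \<in> Z" "x \<in> B z" for x z
  proof -
    have "\<exists>w. (w \<in> Z \<and> x \<in> B w) \<and> (\<forall>y. y \<in> Z \<and> x \<in> B y \<longrightarrow> f w \<le> f y)"
      by (rule ex_has_least_nat) (use x in blast)
    then show ?thesis unfolding Q_def by force
  qed
  then have "(\<Union>z\<in>Z. Q z) = (\<Union>z\<in>Z. B z)" unfolding Q_def by blast
  ultimately show ?thesis
    using assms by (intro that[of Q]) (auto simp: Q_def intro!: sets.Diff sets.finite_UN)
qed

text \<open>Realised as a density, a finite sum of weighted indicators. All measures of the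
  iteration arise this way from the one reference measure, so each has a bounded density.\<close>

lemma weighted_restriction_measure:
  assumes "finite_measure N" "finite Z" "\<And>z. z \<in> Z \<Longrightarrow> G z \<in> sets N" "\<And>z. z \<in> Z \<Longrightarrow> 0 \<le> (w z :: real)"
  obtains \<nu> where "sets \<nu> = sets N" "finite_measure \<nu>"
    "\<And>S. S \<in> sets N \<Longrightarrow> measure \<nu> S = (\<Sum>z\<in>Z. w z * measure N (S \<inter> G z))"
proof -
  interpret finite_measure N by fact
  define \<nu> where "\<nu> = density N (\<lambda>x. \<Sum>z\<in>Z. ennreal (w z) * indicator (G z) x)"
  have em: "emeasure \<nu> S = ennreal (\<Sum>z\<in>Z. w z * measure N (S \<inter> G z))" if S: "S \<in> sets N" for S
  proof -
    have "emeasure \<nu> S = (\<integral>\<^sup>+x. (\<Sum>z\<in>Z. ennreal (w z) * indicator (G z) x) * indicator S x \<partial>N)"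
      unfolding \<nu>_def
    proof (rule emeasure_density[OF _ S])
      show "(\<lambda>x. \<Sum>z\<in>Z. ennreal (w z) * indicator (G z) x) \<in> borel_measurable N"
        by (intro borel_measurable_sum borel_measurable_times_ennreal borel_measurable_const
            borel_measurable_indicator assms(3))
    qed
    also have "\<dots> = (\<integral>\<^sup>+x. (\<Sum>z\<in>Z. ennreal (w z) * indicator (S \<inter> G z) x) \<partial>N)"
      by (intro nn_integral_cong) (auto simp: sum_distrib_right indicator_def intro!: sum.cong)
    also have "\<dots> = (\<Sum>z\<in>Z. \<integral>\<^sup>+x. ennreal (w z) * indicator (S \<inter> G z) x \<partial>N)"
      by (rule nn_integral_sum) (use assms S in auto)
    also have "\<dots> = (\<Sum>z\<in>Z. ennreal (w z * measure N (S \<inter> G z)))"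
      using assms S by (intro sum.cong refl) 
        (simp add: nn_integral_cmult_indicator emeasure_eq_measure ennreal_mult)
    also have "\<dots> = ennreal (\<Sum>z\<in>Z. w z * measure N (S \<inter> G z))"
      using assms by (intro sum_ennreal) auto
    finally show ?thesis .
  qed
  show ?thesis
  proof (rule that[of \<nu>])
    show sets: "sets \<nu> = sets N" by (simp add: \<nu>_def)
    have sp: "space \<nu> = space N" by (simp add: \<nu>_def)
    show "finite_measure \<nu>"
      by standard (use em[of "space N"] sp in auto)
    show "measure \<nu> S = (\<Sum>z\<in>Z. w z * measure N (S \<inter> G z))" if "S \<in> sets N" for S
      using em[OF that] assms(4) by (simp add: measure_def[of \<nu>] sum_nonneg)
  qed
qed

lemma (in finite_measure) sum_measure_disjoint_le:
  assumes "finite Z" "disjoint_family_on Q Z" "A \<in> sets M"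
    "\<And>z. z \<in> Z \<Longrightarrow> Q z \<in> sets M" "\<And>z. z \<in> Z \<Longrightarrow> Q z \<subseteq> A"
  shows "(\<Sum>z\<in>Z. measure M (Q z)) \<le> measure M A"
proof -
  have "(\<Sum>z\<in>Z. measure M (Q z)) = measure M (\<Union>z\<in>Z. Q z)"
    by (rule finite_measure_finite_Union[symmetric]) (use assms in auto)
  also have "\<dots> \<le> measure M A"
    by (rule finite_measure_mono) (use assms in auto)
  finally show ?thesis .
qed

section \<open>The replacement step: from one measure to the next\<close>

text \<open>Divided by \<open>measure N G\<close>, the last condition bounds the normalised
  restriction to \<open>G\<close> by \<open>K * r powr s / \<xi> powr D\<close>, with
  \<open>K\<close> fixed before \<open>x\<close>, \<open>\<xi>\<close> and \<open>k\<close>.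
  Measurability is demanded only of balls and of the sets \<open>G\<close>; a product sigma-algebra
  then qualifies without being compared with the Borel sets of the product metric. The margin
  \<open>\<eta>\<close> says more than inclusion in \<open>T k\<close>: closures of sets built from
  such \<open>G\<close> remain in \<open>T k\<close>.\<close>

locale ahlfors_transfer = Metric_space M d
  for M :: "'a set" and d :: "'a \<Rightarrow> 'a \<Rightarrow> real" +
  fixes N :: "'a measure" and T :: "nat \<Rightarrow> 'a set" and D s c C K r\<^sub>1 :: real
  assumes fin: "finite_measure N"
    and sets_mball: "\<And>x r. mball x r \<in> sets N"
    and c_pos: "0 < c" and C_pos: "0 < C" and K_pos: "0 < K" and r1_pos: "0 < r\<^sub>1"
    and D_ge: "s \<le> D"
    and lower: "\<And>x r. \<lbrakk>x \<in> M; 0 < r; r \<le> r\<^sub>1\<rbrakk> \<Longrightarrow> c * r powr D \<le> measure N (mball x r)"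
    and upper: "\<And>x r. \<lbrakk>x \<in> M; 0 < r; r \<le> r\<^sub>1\<rbrakk> \<Longrightarrow> measure N (mball x r) \<le> C * r powr D"
    and local_mass: "\<And>x \<xi> k. \<lbrakk>x \<in> M; 0 < \<xi>; \<xi> \<le> r\<^sub>1\<rbrakk> \<Longrightarrow>
       \<exists>G\<in>sets N. openin mtopology G \<and> 0 < measure N G \<and>
         (\<exists>\<eta>>0. \<forall>g\<in>G. mball g \<eta> \<subseteq> mball x \<xi> \<inter> T k) \<and>
         (\<forall>y\<in>M. \<forall>r. 0 < r \<and> r \<le> r\<^sub>1 \<longrightarrow>
            measure N (G \<inter> mball y r) \<le> K * r powr s * measure N G / \<xi> powr D)"
begin

lemma card_ball_packing:
  assumes "finite Z" "Z \<subseteq> M" "pairwise (\<lambda>x y. 2 * \<xi> \<le> d x y) Z" "0 < \<xi>" "\<xi> \<le> r\<^sub>1"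
    and "A \<in> sets N" "\<And>z. z \<in> Z \<Longrightarrow> mball z \<xi> \<subseteq> A"
  shows "real (card Z) * (c * \<xi> powr D) \<le> measure N A"
proof (rule card_mult_le_measure[OF fin assms(1)])
  show "disjoint_family_on (\<lambda>z. mball z \<xi>) Z"
    unfolding disjoint_family_on_def
  proof (intro ballI impI)
    fix x y assume xy: "x \<in> Z" "y \<in> Z" "x \<noteq> y"
    then have "2 * \<xi> \<le> d x y" using assms(3) by (auto simp: pairwise_def)
    moreover have "d x y < 2 * \<xi>" if "w \<in> mball x \<xi> \<inter> mball y \<xi>" for w
      using that triangle[of x w y] commute[of y w] by auto
    ultimately show "mball x \<xi> \<inter> mball y \<xi> = {}" by fastforce
  qed
  show "c * \<xi> powr D \<le> measure N (mball z \<xi>)" if "z \<in> Z" for z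
    using lower[of z \<xi>] assms that by auto
qed (use assms sets_mball in auto)

text \<open>As the mesh shrinks, the points whose \<open>\<xi>\<close>-ball fits into
  \<open>\<Omega>\<close> exhaust \<open>\<Omega>\<close>; a maximal separated set of such points
  has doubled balls covering all of them. Only the \<open>\<xi>\<close>-balls must lie in
  \<open>\<Omega>\<close>, since they receive the mass; the doubled balls that give it away may
  stick out.\<close>

lemma inner_net:
  assumes \<nu>: "sets \<nu> = sets N" "finite_measure \<nu>" and \<Omega>: "openin mtopology \<Omega>" "\<Omega> \<in> sets N" "h < measure \<nu> \<Omega>"
    and "0 < \<xi>\<^sub>0"
  obtains \<xi> Z where "0 < \<xi>" "\<xi> \<le> \<xi>\<^sub>0" "finite Z" "Z \<subseteq> M" "pairwise (\<lambda>x y. 2 * \<xi> \<le> d x y) Z"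
    "\<And>z. z \<in> Z \<Longrightarrow> mball z \<xi> \<subseteq> \<Omega>" "h < measure \<nu> (\<Union>z\<in>Z. mball z (2 * \<xi>))"
proof -
  interpret \<nu>: finite_measure \<nu> by fact
  have OM: "\<Omega> \<subseteq> M" using \<Omega>(1) openin_mtopology by blast
  define S where "S \<xi> = {z \<in> M. mball z \<xi> \<subseteq> \<Omega>}" for \<xi>
  define b where "b = min \<xi>\<^sub>0 r\<^sub>1"
  have b: "0 < b" unfolding b_def using assms r1_pos by simp
  define \<xi> where "\<xi> n = b / real (Suc n)" for n
  have \<xi>0: "0 < \<xi> n" for n unfolding \<xi>_def using b by simp
  have \<xi>1: "\<xi> n \<le> min \<xi>\<^sub>0 r\<^sub>1" for n
    unfolding b_def[symmetric] using b by (simp add: \<xi>_def divide_le_eq algebra_simps)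
  have \<xi>lim: "\<xi> \<longlonglongrightarrow> 0"
    unfolding \<xi>_def by (rule LIMSEQ_Suc[OF lim_const_over_n])
  have "\<exists>Z. finite Z \<and> Z \<subseteq> S (\<xi> n) \<and> pairwise (\<lambda>x y. 2 * \<xi> n \<le> d x y) Z
        \<and> S (\<xi> n) \<subseteq> (\<Union>z\<in>Z. mball z (2 * \<xi> n))" for n
  proof -
    let ?\<xi> = "\<xi> n"
    obtain Z where Z: "finite Z" "Z \<subseteq> S ?\<xi>" "pairwise (\<lambda>x y. \<not> d x y < 2 * ?\<xi>) Z"
      "\<And>x. x \<in> S ?\<xi> \<Longrightarrow> \<exists>z\<in>Z. d x z < 2 * ?\<xi>"
    proof (rule maximal_separated_subset[where P = "S ?\<xi>" and near = "\<lambda>x y. d x y < 2 * ?\<xi>"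
          and n = "nat \<lceil>measure N \<Omega> / (c * ?\<xi> powr D)\<rceil>"])
      show "d x x < 2 * ?\<xi>" if "x \<in> S ?\<xi>" for x
        using that \<xi>0[of n] by (simp add: S_def)
      show "d x y < 2 * ?\<xi> \<Longrightarrow> d y x < 2 * ?\<xi>" for x y by (simp add: commute)
      fix Z assume Z: "finite Z" "Z \<subseteq> S ?\<xi>" "pairwise (\<lambda>x y. \<not> d x y < 2 * ?\<xi>) Z"
      have "real (card Z) * (c * ?\<xi> powr D) \<le> measure N \<Omega>"
        by (rule card_ball_packing)
          (use Z \<xi>0[of n] \<xi>1[of n] \<Omega> in \<open>auto simp: S_def pairwise_def not_less\<close>)
      then have "real (card Z) \<le> measure N \<Omega> / (c * ?\<xi> powr D)"
        using c_pos \<xi>0[of n] by (simp add: pos_le_divide_eq)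
      then show "card Z \<le> nat \<lceil>measure N \<Omega> / (c * ?\<xi> powr D)\<rceil>" by linarith
    qed (rule that)
    then show ?thesis
      by (intro exI[of _ Z]) (fastforce simp: S_def not_less commute)
  qed
  then obtain Z where Z: "\<And>n. finite (Z n)" "\<And>n. Z n \<subseteq> S (\<xi> n)"
    "\<And>n. pairwise (\<lambda>x y. 2 * \<xi> n \<le> d x y) (Z n)" "\<And>n. S (\<xi> n) \<subseteq> (\<Union>z\<in>Z n. mball z (2 * \<xi> n))"
    by metis
  define U where "U n = (\<Union>z\<in>Z n. mball z (2 * \<xi> n))" for n
  have Um: "U n \<in> sets \<nu>" for n
    unfolding U_def \<nu>(1) using Z(1) sets_mball by (intro sets.finite_UN) auto
  \<comment> \<open>The nets for different \<open>n\<close> are unrelated, so \<open>U\<close> need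
    not be increasing. Its tail intersections are, which gives access to continuity from
    below.\<close>
  define V where "V m = (\<Inter>n\<in>{m..}. U n)" for m
  have Vm: "V m \<in> sets \<nu>" for m
    unfolding V_def using Um by (intro sets.countable_INT) auto
  have "\<Omega> \<subseteq> (\<Union>m. V m)"
  proof
    fix x assume x: "x \<in> \<Omega>"
    then obtain r where r: "r > 0" "mball x r \<subseteq> \<Omega>" using \<Omega>(1) openin_mtopology by blast
    obtain m where m: "\<And>n. n \<ge> m \<Longrightarrow> \<xi> n < r"
      using order_tendstoD(2)[OF \<xi>lim r(1)] by (auto simp: eventually_sequentially)
    have "x \<in> U n" if "n \<ge> m" for n
    proof -
      have "mball x (\<xi> n) \<subseteq> \<Omega>" using m[OF that] r(2) by fastforce
      then show ?thesis using Z(4)[of n] x OM unfolding U_def S_def by blast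
    qed
    then show "x \<in> (\<Union>m. V m)" by (auto simp: V_def)
  qed
  then have "measure \<nu> \<Omega> \<le> measure \<nu> (\<Union>m. V m)"
    by (rule \<nu>.finite_measure_mono) (use Vm in auto)
  with \<Omega> have "h < measure \<nu> (\<Union>m. V m)" by simp
  moreover have "(\<lambda>m. measure \<nu> (V m)) \<longlonglongrightarrow> measure \<nu> (\<Union>m. V m)"
    by (rule \<nu>.finite_Lim_measure_incseq) (use Vm in \<open>auto simp: incseq_def V_def\<close>)
  ultimately obtain m where m: "h < measure \<nu> (V m)"
    using order_tendstoD(1) by (fastforce simp: eventually_sequentially)
  have "measure \<nu> (V m) \<le> measure \<nu> (U m)"
    by (rule \<nu>.finite_measure_mono) (use Um in \<open>auto simp: V_def\<close>)
  with m show ?thesis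
    using Z[of m] \<xi>0[of m] \<xi>1[of m] by (intro that[of "\<xi> m" "Z m"]) (auto simp: S_def U_def)
qed

text \<open>The invariant of the iteration. \<open>H\<close> is existential because only finiteness
  of the density bound is passed on, while the Frostman constant \<open>A\<close> is a parameter
  because it must stay bounded.\<close>

definition spread :: "real \<Rightarrow> real \<Rightarrow> 'a measure \<Rightarrow> 'a set \<Rightarrow> bool" where
  "spread p A \<nu> \<Omega> \<longleftrightarrow> sets \<nu> = sets N \<and> finite_measure \<nu> \<and>
     (\<exists>H\<ge>0. \<forall>S\<in>sets N. measure \<nu> S \<le> H * measure N S) \<and>
     openin mtopology \<Omega> \<and> \<Omega> \<in> sets N \<and> 1 / 2 < measure \<nu> \<Omega> \<and>
     (\<forall>x\<in>M. \<forall>r>0. measure \<nu> (mball x r) \<le> A * r powr p)"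

lemma spread_step:
  assumes p: "0 < p" "p < s" and A: "0 < A" "A < A'" and sp: "spread p A \<nu> \<Omega>"
  obtains \<nu>' \<Omega>' \<eta> where "spread p A' \<nu>' \<Omega>'" "0 < \<eta>" "\<And>g. g \<in> \<Omega>' \<Longrightarrow> mball g \<eta> \<subseteq> \<Omega> \<inter> T k"
proof -
  from sp obtain H where \<nu>: "sets \<nu> = sets N" "finite_measure \<nu>" "0 \<le> H"
      "\<And>S. S \<in> sets N \<Longrightarrow> measure \<nu> S \<le> H * measure N S"
    and \<Omega>: "openin mtopology \<Omega>" "\<Omega> \<in> sets N" "1 / 2 < measure \<nu> \<Omega>"
    and ball: "\<And>x r. x \<in> M \<Longrightarrow> 0 < r \<Longrightarrow> measure \<nu> (mball x r) \<le> A * r powr p"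
    unfolding spread_def by blast
  interpret \<nu>: finite_measure \<nu> by fact
  interpret N: finite_measure N by (rule fin)
  obtain L where L: "1 < L" "A * (1 + 3 / L) powr p < A'"
    using ex_dilation_factor[of A A' p] A by auto
  define n\<^sub>L where "n\<^sub>L = C * (L + 2) powr D / c"
  \<comment> \<open>\<open>n\<^sub>L\<close> bounds the number of net points whose
    \<open>G z\<close> meets a ball of radius below \<open>L * \<xi>\<close>; the other factor
    bounds what one of them contributes, up to \<open>r powr s\<close>.\<close>
  define B where "B = n\<^sub>L * (H * C * 2 powr D * K)"
  have nL: "0 < n\<^sub>L" unfolding n\<^sub>L_def using C_pos c_pos L by simp
  have B0: "0 \<le> B" unfolding B_def using nL \<nu> C_pos K_pos by simp
  obtain \<xi>1 where \<xi>1: "0 < \<xi>1" "\<And>x. 0 < x \<Longrightarrow> x \<le> \<xi>1 \<Longrightarrow> B * x powr (s - p) < A'"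
    using ex_small_powr[of "s - p" A' B] p A by auto
  \<comment> \<open>The first bound makes the slack at radius \<open>L * \<xi>\<close> beat
    \<open>B\<close>; the second keeps the radius \<open>(L + 2) * \<xi>\<close> of the packing
    argument in the range of \<open>upper\<close>.\<close>
  define \<xi>0 where "\<xi>0 = min (\<xi>1 / L) (r\<^sub>1 / (L + 2))"
  have \<xi>0: "0 < \<xi>0" unfolding \<xi>0_def using \<xi>1 r1_pos L by simp
  obtain \<xi> Z where \<xi>: "0 < \<xi>" "\<xi> \<le> \<xi>0" and Z: "finite Z" "Z \<subseteq> M" "pairwise (\<lambda>x y. 2 * \<xi> \<le> d x y) Z"
    "\<And>z. z \<in> Z \<Longrightarrow> mball z \<xi> \<subseteq> \<Omega>" "1 / 2 < measure \<nu> (\<Union>z\<in>Z. mball z (2 * \<xi>))"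
    using inner_net[OF \<nu>(1,2) \<Omega> \<xi>0] by metis
  have \<xi>B: "B * (L * \<xi>) powr (s - p) < A'"
    using \<xi> \<xi>1(2)[of "L * \<xi>"] L by (auto simp: \<xi>0_def pos_le_divide_eq mult.commute)
  have L\<xi>: "(L + 2) * \<xi> \<le> r\<^sub>1"
    using \<xi> L by (auto simp: \<xi>0_def pos_le_divide_eq mult.commute)
  have L\<xi>': "L * \<xi> + 2 * \<xi> \<le> r\<^sub>1" using L\<xi> by (simp add: algebra_simps)
  have pos: "0 < L * \<xi>" using L \<xi> by simp
  have \<xi>r: "\<xi> \<le> r\<^sub>1" "2 * \<xi> \<le> r\<^sub>1" "L * \<xi> \<le> r\<^sub>1" using L\<xi>' pos \<xi> by linarith+
  obtain Q where Q: "\<And>z. z \<in> Z \<Longrightarrow> Q z \<in> sets N" "\<And>z. z \<in> Z \<Longrightarrow> Q z \<subseteq> mball z (2 * \<xi>)"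
    "disjoint_family_on Q Z" "(\<Union>z\<in>Z. Q z) = (\<Union>z\<in>Z. mball z (2 * \<xi>))"
    using finite_disjointed_sets[of Z "\<lambda>z. mball z (2 * \<xi>)" N] Z(1) sets_mball by blast
  define fit where "fit z G \<eta> \<longleftrightarrow> G \<in> sets N \<and> openin mtopology G \<and> 0 < measure N G \<and>
      0 < \<eta> \<and> (\<forall>g\<in>G. mball g \<eta> \<subseteq> mball z \<xi> \<inter> T k) \<and>
      (\<forall>y\<in>M. \<forall>r. 0 < r \<and> r \<le> r\<^sub>1 \<longrightarrow>
         measure N (G \<inter> mball y r) \<le> K * r powr s * measure N G / \<xi> powr D)" for z G \<eta>
  have "\<exists>G \<eta>. fit z G \<eta>" if "z \<in> Z" for z
  proof -
    have "z \<in> M" using that Z by blast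
    from local_mass[OF this \<xi>(1) \<xi>r(1), of k] show ?thesis unfolding fit_def by blast
  qed
  then obtain G e where fit: "\<And>z. z \<in> Z \<Longrightarrow> fit z (G z) (e z)"
    by metis
  have G: "\<And>z. z \<in> Z \<Longrightarrow> G z \<in> sets N" "\<And>z. z \<in> Z \<Longrightarrow> openin mtopology (G z)"
      "\<And>z. z \<in> Z \<Longrightarrow> 0 < measure N (G z)"
      "\<And>z. z \<in> Z \<Longrightarrow> 0 < e z" "\<And>z g. z \<in> Z \<Longrightarrow> g \<in> G z \<Longrightarrow> mball g (e z) \<subseteq> mball z \<xi> \<inter> T k"
      "\<And>z y r. z \<in> Z \<Longrightarrow> y \<in> M \<Longrightarrow> 0 < r \<Longrightarrow> r \<le> r\<^sub>1 \<Longrightarrow>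
         measure N (G z \<inter> mball y r) \<le> K * r powr s * measure N (G z) / \<xi> powr D"
    using fit unfolding fit_def by blast+
  have Gsub: "G z \<subseteq> mball z \<xi>" if "z \<in> Z" for z
  proof
    fix g assume g: "g \<in> G z"
    then have "g \<in> M" using G(2)[OF that] openin_mtopology by blast
    then have "g \<in> mball g (e z)" using G(4)[OF that] by simp
    then show "g \<in> mball z \<xi>" using G(5)[OF that g] by blast
  qed
  \<comment> \<open>All mass that \<open>\<nu>\<close> gives to the piece \<open>Q z\<close> is
    spread evenly over \<open>G z\<close>, so the total over \<open>Z\<close> is that of the union
    of the doubled balls.\<close>
  define w where "w z = measure \<nu> (Q z) / measure N (G z)" for z
  have w0: "0 \<le> w z" for z by (simp add: w_def)
  obtain \<nu>' where \<nu>': "sets \<nu>' = sets N" "finite_measure \<nu>'"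
    "\<And>S. S \<in> sets N \<Longrightarrow> measure \<nu>' S = (\<Sum>z\<in>Z. w z * measure N (S \<inter> G z))"
    using weighted_restriction_measure[OF fin Z(1), of G w] G w0 by blast
  define \<Omega>' where "\<Omega>' = (\<Union>z\<in>Z. G z)"
  have \<Omega>'m: "\<Omega>' \<in> sets N" unfolding \<Omega>'_def using Z G by (intro sets.finite_UN) auto
  have wG: "w z * measure N (S \<inter> G z) \<le> measure \<nu> (Q z)" if "z \<in> Z" for z S
  proof -
    have "measure N (S \<inter> G z) \<le> measure N (G z)"
      by (rule N.finite_measure_mono) (use G that in auto)
    then have "w z * measure N (S \<inter> G z) \<le> w z * measure N (G z)" by (rule mult_left_mono[OF _ w0])
    also have "\<dots> = measure \<nu> (Q z)" using G(3)[OF that] by (simp add: w_def)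
    finally show ?thesis .
  qed
  have "measure \<nu>' \<Omega>' = (\<Sum>z\<in>Z. measure \<nu> (Q z))"
  proof -
    have "\<Omega>' \<inter> G z = G z" if "z \<in> Z" for z using that by (auto simp: \<Omega>'_def)
    then show ?thesis using G(3) by (subst \<nu>'(3)[OF \<Omega>'m], intro sum.cong) (auto simp: w_def less_le)
  qed
  also have "\<dots> = measure \<nu> (\<Union>z\<in>Z. Q z)"
    by (rule \<nu>.finite_measure_finite_Union[symmetric]) (use Z Q \<nu>(1) in auto)
  finally have half: "1 / 2 < measure \<nu>' \<Omega>'" using Z(5) Q(4) by simp
  have ball': "measure \<nu>' (mball x r) \<le> A' * r powr p" if x: "x \<in> M" and r: "0 < r" for x r
  proof -
    define Y where "Y = {z \<in> Z. G z \<inter> mball x r \<noteq> {}}"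
    have Y: "finite Y" "Y \<subseteq> Z" using Z(1) by (auto simp: Y_def)
    have near: "d x z < r + \<xi>" if "z \<in> Y" for z
    proof -
      obtain g where g: "g \<in> G z" "g \<in> mball x r" and zZ: "z \<in> Z" using \<open>z \<in> Y\<close> unfolding Y_def by blast
      have "d z g < \<xi>" "z \<in> M" using Gsub[OF zZ] g by auto
      with g triangle[of x g z] commute[of z g] show ?thesis by auto
    qed
    have grow: "mball z q \<subseteq> mball x (r + \<xi> + q)" if "z \<in> Y" for z q
    proof
      fix y assume y: "y \<in> mball z q"
      then have "d x y \<le> d x z + d z y" using triangle x by auto
      with near[OF that] y x show "y \<in> mball x (r + \<xi> + q)" by auto
    qed
    have "measure \<nu>' (mball x r) = (\<Sum>z\<in>Z. w z * measure N (mball x r \<inter> G z))"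
      by (rule \<nu>'(3)[OF sets_mball])
    also have "\<dots> = (\<Sum>z\<in>Y. w z * measure N (mball x r \<inter> G z))"
      by (rule sum.mono_neutral_right) (use Z(1) in \<open>auto simp: Y_def Int_commute\<close>)
    finally have eq: "measure \<nu>' (mball x r) = (\<Sum>z\<in>Y. w z * measure N (mball x r \<inter> G z))" .
    show ?thesis
    proof (cases "L * \<xi> \<le> r")
      case True
      have "measure \<nu>' (mball x r) \<le> (\<Sum>z\<in>Y. measure \<nu> (Q z))"
        unfolding eq using Y wG by (intro sum_mono) auto
      also have "\<dots> \<le> measure \<nu> (mball x (r + \<xi> + 2 * \<xi>))"
      proof (rule \<nu>.sum_measure_disjoint_le[OF Y(1)])
        show "disjoint_family_on Q Y" using Q(3) Y(2) by (rule disjoint_family_on_mono[rotated])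
        show "Q z \<subseteq> mball x (r + \<xi> + 2 * \<xi>)" if "z \<in> Y" for z
          using grow[OF that, of "2 * \<xi>"] Q(2)[of z] Y(2) that by blast
      qed (use Q Y \<nu>(1) sets_mball in auto)
      also have "\<dots> \<le> A * (r + \<xi> + 2 * \<xi>) powr p"
        by (rule ball) (use x r \<xi> in auto)
      also have "\<dots> \<le> A * ((1 + 3 / L) * r) powr p"
      proof -
        have "3 * \<xi> \<le> 3 / L * r" using True L by (simp add: field_simps)
        then have "r + \<xi> + 2 * \<xi> \<le> (1 + 3 / L) * r" by (simp add: algebra_simps)
        then show ?thesis using A p r \<xi> by (intro mult_left_mono powr_mono2) auto
      qed
      also have "\<dots> = A * (1 + 3 / L) powr p * r powr p"
        using L r by (simp add: powr_mult)
      also have "\<dots> \<le> A' * r powr p" using L by (intro mult_right_mono) auto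
      finally show ?thesis .
    next
      case False
      then have rL: "r < L * \<xi>" by simp
      have "real (card Y) * (c * \<xi> powr D) \<le> measure N (mball x ((L + 2) * \<xi>))"
      proof (rule card_ball_packing[OF Y(1)])
        show "Y \<subseteq> M" using Y Z by blast
        show "pairwise (\<lambda>x y. 2 * \<xi> \<le> d x y) Y" using Z(3) Y(2) by (rule pairwise_subset)
        show "mball z \<xi> \<subseteq> mball x ((L + 2) * \<xi>)" if "z \<in> Y" for z
        proof -
          have "mball x (r + \<xi> + \<xi>) \<subseteq> mball x ((L + 2) * \<xi>)"
            using rL by (intro mball_subset_concentric) (simp add: algebra_simps)
          with grow[OF that, of \<xi>] show ?thesis by blast
        qed
      qed (use \<xi> \<xi>r sets_mball in auto)
      also have "\<dots> \<le> C * ((L + 2) * \<xi>) powr D"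
        by (rule upper) (use x L \<xi> L\<xi> in auto)
      also have "\<dots> = n\<^sub>L * (c * \<xi> powr D)"
        unfolding n\<^sub>L_def using L \<xi> c_pos by (simp add: powr_mult)
      finally have cardY: "real (card Y) \<le> n\<^sub>L" using c_pos \<xi> by simp
      have each: "w z * measure N (mball x r \<inter> G z) \<le> H * C * 2 powr D * K * r powr s" if "z \<in> Y" for z
      proof -
        have zZ: "z \<in> Z" and zM: "z \<in> M" using that Y Z by auto
        have "measure \<nu> (Q z) \<le> measure \<nu> (mball z (2 * \<xi>))"
          by (rule \<nu>.finite_measure_mono) (use Q zZ \<nu>(1) sets_mball in auto)
        also have "\<dots> \<le> H * measure N (mball z (2 * \<xi>))" by (rule \<nu>(4)[OF sets_mball])
        also have "\<dots> \<le> H * (C * (2 * \<xi>) powr D)"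
          using \<nu>(3) upper[of z "2 * \<xi>"] zM \<xi> \<xi>r by (intro mult_left_mono) auto
        finally have q: "measure \<nu> (Q z) \<le> H * (C * (2 * \<xi>) powr D)" .
        have "measure N (mball x r \<inter> G z) \<le> K * r powr s * measure N (G z) / \<xi> powr D"
          using G(6)[OF zZ x r] rL \<xi>r by (simp add: Int_commute)
        then have "w z * measure N (mball x r \<inter> G z) \<le> w z * (K * r powr s * measure N (G z) / \<xi> powr D)"
          by (rule mult_left_mono[OF _ w0])
        also have "\<dots> = measure \<nu> (Q z) * (K * r powr s / \<xi> powr D)"
          using G(3)[OF zZ] by (simp add: w_def)
        also have "\<dots> \<le> H * (C * (2 * \<xi>) powr D) * (K * r powr s / \<xi> powr D)"
          by (rule mult_right_mono[OF q]) (use K_pos in auto)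
        also have "\<dots> = H * C * 2 powr D * K * r powr s" using \<xi> by (simp add: powr_mult)
        finally show ?thesis .
      qed
      have "measure \<nu>' (mball x r) \<le> (\<Sum>z\<in>Y. H * C * 2 powr D * K * r powr s)"
        unfolding eq by (rule sum_mono) (rule each)
      also have "\<dots> = real (card Y) * (H * C * 2 powr D * K * r powr s)" by simp
      also have "\<dots> \<le> n\<^sub>L * (H * C * 2 powr D * K * r powr s)"
        using cardY \<nu>(3) C_pos K_pos by (intro mult_right_mono) auto
      \<comment> \<open>Splitting off \<open>r powr (s - p)\<close> isolates the slack, which is
        largest at the threshold radius \<open>L * \<xi>\<close>, where \<open>\<xi>B\<close>
        controls it.\<close>
      also have "\<dots> = B * r powr (s - p) * r powr p"
        unfolding B_def using r by (simp add: powr_diff)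
      also have "\<dots> \<le> B * (L * \<xi>) powr (s - p) * r powr p"
        using rL r p B0 by (intro mult_right_mono mult_left_mono powr_mono2) auto
      also have "\<dots> \<le> A' * r powr p" using \<xi>B by (intro mult_right_mono) auto
      finally show ?thesis .
    qed
  qed
  \<comment> \<open>The new density bound is the sum of the weights, whatever its size.\<close>
  have dens: "measure \<nu>' S \<le> (\<Sum>z\<in>Z. w z) * measure N S" if "S \<in> sets N" for S
    unfolding \<nu>'(3)[OF that] sum_distrib_right
    by (intro sum_mono mult_left_mono w0 N.finite_measure_mono) (use that in auto)
  define \<eta> where "\<eta> = Min (insert 1 (e ` Z))"
  have \<eta>: "0 < \<eta>" unfolding \<eta>_def using Z(1) G(4) by (subst Min_gr_iff) auto
  have \<eta>e: "\<eta> \<le> e z" if "z \<in> Z" for z unfolding \<eta>_def using Z(1) that by auto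
  show ?thesis
  proof (rule that[of \<nu>' \<Omega>' \<eta>])
    show "spread p A' \<nu>' \<Omega>'"
      unfolding spread_def
    proof (intro conjI)
      show "openin mtopology \<Omega>'" unfolding \<Omega>'_def using G(2) by blast
      show "\<exists>H\<ge>0. \<forall>S\<in>sets N. measure \<nu>' S \<le> H * measure N S"
        using dens w0 by (intro exI[of _ "\<Sum>z\<in>Z. w z"]) (auto intro: sum_nonneg)
    qed (use \<nu>' \<Omega>'m half ball' in auto)
    show "mball g \<eta> \<subseteq> \<Omega> \<inter> T k" if g: "g \<in> \<Omega>'" for g
    proof -
      obtain z where z: "z \<in> Z" "g \<in> G z" using g by (auto simp: \<Omega>'_def)
      have "mball g \<eta> \<subseteq> mball g (e z)" using \<eta>e[OF z(1)] by (rule mball_subset_concentric)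
      also have "\<dots> \<subseteq> mball z \<xi> \<inter> T k" using G(5) z by blast
      finally show ?thesis using Z(4)[OF z(1)] by blast
    qed
  qed (rule \<eta>)
qed

end

section \<open>From uniformly spread measures to Hausdorff dimension\<close>

text \<open>The content at scale 1 already lies below the measure. Diameters at most 1 ensure that
  raising the exponent later does not increase the sums, and finite partial sums suffice because
  compactness will retain finitely many covering sets.\<close>

lemma hausdorff_measure_zero_cover:
  fixes dd :: "'b \<Rightarrow> 'b \<Rightarrow> real"
  assumes "hausdorff_measure dd p E = 0" "0 < \<epsilon>"
  shows "\<exists>(U :: nat \<Rightarrow> 'b set) q. E \<subseteq> (\<Union>k. U k) \<and> (\<forall>k. 0 \<le> q k \<and> q k \<le> 1) \<and>
    (\<forall>k. \<forall>x\<in>U k. \<forall>y\<in>U k. dd x y \<le> q k) \<and> (\<forall>F. finite F \<longrightarrow> (\<Sum>k\<in>F. q k powr p) < \<epsilon>)"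
proof -
  have "hausdorff_content dd p 1 E \<le> hausdorff_measure dd p E"
    unfolding hausdorff_measure_def by (rule SUP_upper) simp
  then have "hausdorff_content dd p 1 E < ennreal \<epsilon>" using assms by simp
  then obtain U :: "nat \<Rightarrow> 'b set" where U: "E \<subseteq> (\<Union>k. U k)" "\<And>k. gdiam dd (U k) \<le> 1"
      "(\<Sum>k. diam_pow dd p (U k)) < ennreal \<epsilon>"
    unfolding hausdorff_content_def INF_less_iff by auto
  define q where "q k = enn2real (gdiam dd (U k))" for k
  have g: "gdiam dd (U k) = ennreal (q k)" for k
    unfolding q_def using order_le_less_trans[OF U(2)[of k] ennreal_one_less_top] by simp
  have q0: "0 \<le> q k" for k by (simp add: q_def)
  show ?thesis
  proof (intro exI[of _ U] exI[of _ q] conjI allI ballI impI U(1) q0)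
    show "q k \<le> 1" for k using U(2)[of k] g[of k] q0[of k] by simp
    show "dd x y \<le> q k" if "x \<in> U k" "y \<in> U k" for k x y
    proof -
      have "ennreal (dd x y) \<le> (SUP y\<in>U k. ennreal (dd x y))" by (rule SUP_upper[OF that(2)])
      also have "\<dots> \<le> gdiam dd (U k)" unfolding gdiam_def by (rule SUP_upper[OF that(1)])
      finally show ?thesis using q0[of k] by (simp add: g)
    qed
    show "(\<Sum>k\<in>F. q k powr p) < \<epsilon>" if "finite F" for F
    proof -
      have "ennreal (\<Sum>k\<in>F. q k powr p) = (\<Sum>k\<in>F. diam_pow dd p (U k))"
        by (simp add: diam_pow_def q_def sum_ennreal)
      also have "\<dots> \<le> (\<Sum>k. diam_pow dd p (U k))"
        by (rule sum_le_suminf) (use that in auto)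
      also note U(3)
      finally show ?thesis by (simp add: ennreal_less_iff sum_nonneg)
    qed
  qed
qed

text \<open>Covering sets need not be open and may have diameter 0. They are replaced by open balls
  of strictly larger radius, and the price is controlled in the quantity that gets summed.\<close>

lemma ex_larger_powr:
  fixes q p e :: real
  assumes "0 \<le> q" "0 < p" "0 < e"
  obtains \<rho> where "q < \<rho>" "\<rho> powr p = q powr p + e"
proof -
  have "q = (q powr p) powr (1 / p)" using assms by (simp add: powr_powr)
  also have "\<dots> < (q powr p + e) powr (1 / p)"
    using assms by (intro powr_less_mono2) auto
  finally show ?thesis using assms by (intro that) (auto simp: powr_powr add_nonneg_nonneg)
qed

context ahlfors_transfer begin

lemma spread_ball:
  assumes "x\<^sub>0 \<in> M" "0 < R" "0 < p" "p < s"
  obtains A \<nu> where "0 < A" "spread p A \<nu> (mball x\<^sub>0 R)"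
proof -
  interpret N: finite_measure N by (rule fin)
  let ?O = "mball x\<^sub>0 R"
  have "0 < c * (min R r\<^sub>1) powr D" using c_pos assms r1_pos by simp
  also have "\<dots> \<le> measure N (mball x\<^sub>0 (min R r\<^sub>1))" using lower assms r1_pos by simp
  also have "\<dots> \<le> measure N ?O"
    by (intro N.finite_measure_mono mball_subset_concentric sets_mball) simp
  finally have N0: "0 < measure N ?O" .
  define w where "w = 1 / measure N ?O"
  have w: "0 < w" using N0 by (simp add: w_def)
  obtain \<nu> where \<nu>: "sets \<nu> = sets N" "finite_measure \<nu>"
    "\<And>S. S \<in> sets N \<Longrightarrow> measure \<nu> S = (\<Sum>z\<in>{()}. w * measure N (S \<inter> ?O))"
    using weighted_restriction_measure[OF fin, of "{()}" "\<lambda>_. ?O" "\<lambda>_. w"] sets_mball w by auto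
  have dens: "measure \<nu> S \<le> w * measure N S" if "S \<in> sets N" for S
    using \<nu>(3)[OF that] w that by (simp add: N.finite_measure_mono)
  define b where "b = min r\<^sub>1 1"
  have b: "0 < b" "b \<le> r\<^sub>1" "b \<le> 1" using r1_pos by (auto simp: b_def)
  \<comment> \<open>The first summand serves radii up to \<open>b\<close>, where regularity applies
    and \<open>r \<le> 1\<close> lets \<open>r powr D\<close> be replaced by
    \<open>r powr p\<close>; the second serves larger radii, where the total mass 1 is bound
    enough.\<close>
  define A where "A = w * C + b powr (- p)"
  have A: "0 < A" using w C_pos b by (simp add: A_def add_pos_pos)
  have "measure \<nu> (mball x r) \<le> A * r powr p" if x: "x \<in> M" "0 < r" for x r
  proof (cases "r \<le> b")
    case True
    have "measure \<nu> (mball x r) \<le> w * measure N (mball x r)" by (rule dens[OF sets_mball])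
    also have "\<dots> \<le> w * (C * r powr D)"
      using upper[of x r] x True b w by (intro mult_left_mono) auto
    also have "\<dots> \<le> w * (C * r powr p)"
      using w C_pos x True b assms D_ge by (intro mult_left_mono powr_mono') auto
    also have "\<dots> \<le> A * r powr p" by (simp add: A_def algebra_simps)
    finally show ?thesis .
  next
    case False
    have "measure N (mball x r \<inter> ?O) \<le> measure N ?O"
      by (intro N.finite_measure_mono sets_mball) simp
    then have "measure \<nu> (mball x r) \<le> 1"
      using \<nu>(3)[OF sets_mball] w N0 by (simp add: w_def divide_le_eq)
    also have "1 = b powr (- p) * b powr p" using b by (simp flip: powr_add)
    also have "\<dots> \<le> b powr (- p) * r powr p"
      using False b assms by (intro mult_left_mono powr_mono2) auto
    also have "\<dots> \<le> A * r powr p" using w C_pos by (simp add: A_def algebra_simps)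
    finally show ?thesis .
  qed
  moreover have "measure \<nu> ?O = 1" using \<nu>(3)[OF sets_mball] N0 by (simp add: w_def)
  moreover have "\<exists>H\<ge>0. \<forall>S\<in>sets N. measure \<nu> S \<le> H * measure N S"
    using dens w by (intro exI[of _ w]) auto
  ultimately have "spread p A \<nu> ?O"
    unfolding spread_def using \<nu>(1,2) sets_mball by simp
  with A show ?thesis by (rule that)
qed

theorem hausdorff_measure_nonzero:
  assumes p: "0 \<le> p" "p < s" and x0: "x\<^sub>0 \<in> M" "0 < R"
    and cpt: "compactin mtopology S" "mball x\<^sub>0 R \<subseteq> S"
    and E: "M \<inter> (\<Inter>k. T k) \<subseteq> E"
  shows "hausdorff_measure d p E \<noteq> 0"
proof
  assume zero: "hausdorff_measure d p E = 0"
  \<comment> \<open>\<open>p\<close> may be 0, and \<open>0 powr 0 = 0\<close> would then make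
    single points free of charge. A positive exponent still below \<open>s\<close> allows every
    covering set to be fattened at small cost.\<close>
  define p' where "p' = (p + s) / 2"
  have p': "0 < p'" "p' < s" "p \<le> p'" using p by (auto simp: p'_def)
  obtain A\<^sub>0 \<nu>\<^sub>0 where A0: "0 < A\<^sub>0" "spread p' A\<^sub>0 \<nu>\<^sub>0 (mball x\<^sub>0 R)"
    using spread_ball[OF x0 p'(1,2)] .
  \<comment> \<open>Strictly increasing, as \<open>spread_step\<close> demands at every stage, yet
    bounded by \<open>2 * A\<^sub>0\<close>.\<close>
  define A where "A k = A\<^sub>0 * (2 - 1 / 2 ^ k)" for k :: nat
  have A_pos: "0 < A k" for k
  proof -
    have "1 / 2 ^ k \<le> (1::real)" by simp
    then have "0 < 2 - 1 / (2::real) ^ k" by linarith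
    then show ?thesis using A0 by (simp only: A_def zero_less_mult_iff) simp
  qed
  have A_Suc: "A k < A (Suc k)" for k
    unfolding A_def using A0 by (intro mult_strict_left_mono diff_strict_left_mono) (auto simp: field_simps)
  have A_le: "A k \<le> 2 * A\<^sub>0" for k using A0 by (simp add: A_def)
  \<comment> \<open>The clause for \<open>k = 0\<close> pins the first open set to the given ball,
    which is how the compact set \<open>S\<close> enters.\<close>
  have "\<exists>f. \<forall>k. (spread p' (A k) (fst (f k)) (snd (f k)) \<and> (k = 0 \<longrightarrow> snd (f k) = mball x\<^sub>0 R))
      \<and> (\<exists>\<eta>>0. \<forall>g\<in>snd (f (Suc k)). mball g \<eta> \<subseteq> snd (f k) \<inter> T k)"
  proof (rule dependent_nat_choice[where P = "\<lambda>k x. spread p' (A k) (fst x) (snd x) \<and> (k = 0 \<longrightarrow> snd x = mball x\<^sub>0 R)"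
        and Q = "\<lambda>k x y. \<exists>\<eta>>0. \<forall>g\<in>snd y. mball g \<eta> \<subseteq> snd x \<inter> T k"])
    show "\<exists>x. spread p' (A 0) (fst x) (snd x) \<and> (0 = (0::nat) \<longrightarrow> snd x = mball x\<^sub>0 R)"
      using A0 by (intro exI[of _ "(\<nu>\<^sub>0, mball x\<^sub>0 R)"]) (simp add: A_def)
    fix x k assume "spread p' (A k) (fst x) (snd x) \<and> (k = 0 \<longrightarrow> snd x = mball x\<^sub>0 R)"
    then have "spread p' (A k) (fst x) (snd x)" by (rule conjunct1)
    then obtain \<nu>' \<Omega>' \<eta> where "spread p' (A (Suc k)) \<nu>' \<Omega>'" "0 < \<eta>"
        "\<And>g. g \<in> \<Omega>' \<Longrightarrow> mball g \<eta> \<subseteq> snd x \<inter> T k"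
      by (rule spread_step[OF p'(1,2) A_pos A_Suc, where k = k]) (rule that)
    then show "\<exists>y. (spread p' (A (Suc k)) (fst y) (snd y) \<and> (Suc k = 0 \<longrightarrow> snd y = mball x\<^sub>0 R))
      \<and> (\<exists>\<eta>>0. \<forall>g\<in>snd y. mball g \<eta> \<subseteq> snd x \<inter> T k)"
      by (intro exI[of _ "(\<nu>', \<Omega>')"]) auto
  qed
  then obtain f where f': "\<And>k. (spread p' (A k) (fst (f k)) (snd (f k)) \<and> (k = 0 \<longrightarrow> snd (f k) = mball x\<^sub>0 R))
      \<and> (\<exists>\<eta>>0. \<forall>g\<in>snd (f (Suc k)). mball g \<eta> \<subseteq> snd (f k) \<inter> T k)"
    by (elim exE) (rule that, erule spec)
  have f: "\<And>k. spread p' (A k) (fst (f k)) (snd (f k))" "snd (f 0) = mball x\<^sub>0 R"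
      "\<And>k. \<exists>\<eta>>0. \<forall>g\<in>snd (f (Suc k)). mball g \<eta> \<subseteq> snd (f k) \<inter> T k"
    using f' f'[of 0] by simp_all
  define \<nu> where "\<nu> k = fst (f k)" for k
  define \<Omega> where "\<Omega> k = snd (f k)" for k
  define Cl where "Cl k = mtopology closure_of \<Omega> k" for k
  have sp: "spread p' (A k) (\<nu> k) (\<Omega> k)" for k using f(1) by (simp add: \<nu>_def \<Omega>_def)
  have \<Omega>M: "\<Omega> k \<subseteq> M" for k using sp[of k] openin_mtopology by (auto simp: spread_def)
  have \<Omega>Cl: "\<Omega> k \<subseteq> Cl k" for k unfolding Cl_def using \<Omega>M by (intro closure_of_subset) simp
  \<comment> \<open>A closure point of the next open set is within the margin \<open>\<eta>\<close>
    of one of its points. Hence points in all \<open>Cl k\<close> lie in all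
    \<open>T k\<close>.\<close>
  have Cl_Suc: "Cl (Suc k) \<subseteq> \<Omega> k \<inter> T k" for k
  proof
    fix x assume x: "x \<in> Cl (Suc k)"
    obtain \<eta> where \<eta>: "0 < \<eta>" "\<And>g. g \<in> \<Omega> (Suc k) \<Longrightarrow> mball g \<eta> \<subseteq> \<Omega> k \<inter> T k"
      using f(3)[of k] by (auto simp: \<Omega>_def)
    obtain g where g: "g \<in> \<Omega> (Suc k)" "g \<in> mball x \<eta>"
      using x \<eta>(1) unfolding Cl_def metric_closure_of by blast
    then have "x \<in> mball g \<eta>" by (simp add: commute)
    with \<eta>(2)[OF g(1)] show "x \<in> \<Omega> k \<inter> T k" by blast
  qed
  have Cl_dec: "Cl l \<subseteq> Cl k" if "k \<le> l" for k l
    using that by (rule lift_Suc_antimono_le[rotated]) (use Cl_Suc \<Omega>Cl in blast)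
  \<comment> \<open>Index 1, since the closure of the starting ball itself might leave
    \<open>S\<close>, whereas \<open>Cl 1\<close> lies inside that ball.\<close>
  have Cl_cpt: "compactin mtopology (Cl 1)"
  proof (rule closed_compactin[OF cpt(1)])
    show "Cl 1 \<subseteq> S" using Cl_Suc[of 0] f(2) cpt(2) by (auto simp: \<Omega>_def)
  qed (simp add: Cl_def)
  \<comment> \<open>Chosen so that the final estimate
    \<open>2 * A\<^sub>0 * (2 * \<epsilon>)\<close> equals 1/2, against mass strictly above 1/2. One
    \<open>\<epsilon>\<close> pays for the cover, the other for the enlarged radii, whose increments
    form a geometric series.\<close>
  define \<epsilon> where "\<epsilon> = 1 / (8 * A\<^sub>0)"
  have \<epsilon>: "0 < \<epsilon>" using A0 by (simp add: \<epsilon>_def)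
  obtain U :: "nat \<Rightarrow> 'a set" and q where Uq: "E \<subseteq> (\<Union>k. U k) \<and> (\<forall>k. 0 \<le> q k \<and> q k \<le> 1) \<and>
    (\<forall>k. \<forall>x\<in>U k. \<forall>y\<in>U k. d x y \<le> q k) \<and> (\<forall>F. finite F \<longrightarrow> (\<Sum>k\<in>F. q k powr p) < \<epsilon>)"
    using hausdorff_measure_zero_cover[OF zero \<epsilon>] by (elim exE) (rule that)
  then have U: "E \<subseteq> (\<Union>k. U k)" "\<And>k. 0 \<le> q k" "\<And>k. q k \<le> 1"
      "\<And>k x y. x \<in> U k \<Longrightarrow> y \<in> U k \<Longrightarrow> d x y \<le> q k"
      "\<And>F. finite F \<Longrightarrow> (\<Sum>k\<in>F. q k powr p) < \<epsilon>"
    by simp_all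
  have "\<forall>k. \<exists>\<rho>. q k < \<rho> \<and> \<rho> powr p' = q k powr p' + \<epsilon> * (1 / 2) ^ Suc k"
  proof
    fix k
    have "0 < \<epsilon> * (1 / 2) ^ Suc k" using \<epsilon> by simp
    from ex_larger_powr[OF U(2)[of k] p'(1) this]
    show "\<exists>\<rho>. q k < \<rho> \<and> \<rho> powr p' = q k powr p' + \<epsilon> * (1 / 2) ^ Suc k" by blast
  qed
  from choice[OF this] obtain \<rho>
    where \<rho>: "\<And>k. q k < \<rho> k" "\<And>k. \<rho> k powr p' = q k powr p' + \<epsilon> * (1 / 2) ^ Suc k"
    by blast
  \<comment> \<open>The covering sets are not confined to \<open>M\<close>; one that misses
    \<open>M\<close> is given an arbitrary centre.\<close>
  have "\<exists>y. y \<in> M \<and> (U k \<inter> M \<noteq> {} \<longrightarrow> y \<in> U k)" for k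
    using x0 by blast
  then obtain y where y: "\<And>k. y k \<in> M" "\<And>k. U k \<inter> M \<noteq> {} \<Longrightarrow> y k \<in> U k"
    by metis
  define V where "V k = mball (y k) (\<rho> k)" for k
  \<comment> \<open>Points that drop out of some \<open>Cl k\<close> are handled by open
    complements. A finite subcover involves finitely many of these, so on a late
    \<open>\<Omega> n\<close> the balls alone must cover.\<close>
  have cover: "Cl 1 \<subseteq> \<Union>(range V \<union> range (\<lambda>k. M - Cl k))"
  proof
    fix x assume "x \<in> Cl 1"
    then have xM: "x \<in> M" using Cl_Suc[of 0] \<Omega>M[of 0] by auto
    show "x \<in> \<Union>(range V \<union> range (\<lambda>k. M - Cl k))"
    proof (cases "\<forall>k. x \<in> Cl k")
      case True
      then have "x \<in> T k" for k using Cl_Suc[of k] by blast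
      with xM E U(1) obtain k where k: "x \<in> U k" by blast
      then have "d (y k) x \<le> q k" using U(4) y xM by blast
      then have "x \<in> V k" using \<rho>(1)[of k] xM y by (auto simp: V_def)
      then show ?thesis by blast
    qed (use xM in blast)
  qed
  have "openin mtopology W" if "W \<in> range V \<union> range (\<lambda>k. M - Cl k)" for W
    using that by (auto simp: V_def Cl_def intro!: openin_diff[OF openin_topspace, of mtopology, simplified])
  with compactinD[OF Cl_cpt _ cover] obtain \<F> where \<F>: "finite \<F>" "\<F> \<subseteq> range V \<union> range (\<lambda>k. M - Cl k)" "Cl 1 \<subseteq> \<Union>\<F>"
    by blast
  have "finite (\<F> \<inter> range V)" "finite (\<F> \<inter> range (\<lambda>k. M - Cl k))"
    using \<F>(1) by blast+
  note this[THEN finite_subset_image, OF inf_le2]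
  then obtain F I where F: "finite F" "\<F> \<inter> range V = V ` F"
    and I: "finite I" "\<F> \<inter> range (\<lambda>k. M - Cl k) = (\<lambda>k. M - Cl k) ` I"
    by (elim exE conjE) (rule that)
  \<comment> \<open>Including 1 places \<open>Cl n\<close> inside the compact set
    \<open>Cl 1\<close>.\<close>
  define n where "n = Max (insert 1 I)"
  have n: "1 \<le> n" "\<And>k. k \<in> I \<Longrightarrow> k \<le> n" using I(1) by (auto simp: n_def)
  have "\<Omega> n \<subseteq> (\<Union>k\<in>F. V k)"
  proof
    fix x assume "x \<in> \<Omega> n"
    then have x: "x \<in> Cl n" using \<Omega>Cl by blast
    then have "x \<in> Cl 1" using Cl_dec[OF n(1)] by blast
    then obtain W where W: "x \<in> W" "W \<in> \<F>" using \<F>(3) by blast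
    from W(2) \<F>(2) have "W \<in> \<F> \<inter> range V \<or> W \<in> \<F> \<inter> range (\<lambda>k. M - Cl k)" by blast
    then show "x \<in> (\<Union>k\<in>F. V k)"
    proof
      assume "W \<in> \<F> \<inter> range V"
      then show ?thesis unfolding F(2) using W(1) by auto
    next
      assume "W \<in> \<F> \<inter> range (\<lambda>k. M - Cl k)"
      then obtain k where "k \<in> I" "W = M - Cl k" unfolding I(2) by auto
      then show ?thesis using Cl_dec[OF n(2)] x W(1) by auto
    qed
  qed
  moreover from sp[of n] have \<nu>: "sets (\<nu> n) = sets N" "finite_measure (\<nu> n)" "1 / 2 < measure (\<nu> n) (\<Omega> n)"
      "\<And>x r. x \<in> M \<Longrightarrow> 0 < r \<Longrightarrow> measure (\<nu> n) (mball x r) \<le> A n * r powr p'"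
    by (auto simp: spread_def)
  ultimately have "measure (\<nu> n) (\<Omega> n) \<le> measure (\<nu> n) (\<Union>k\<in>F. V k)"
    using F(1) sets_mball by (intro finite_measure.finite_measure_mono) (auto simp: V_def)
  also have "\<dots> \<le> (\<Sum>k\<in>F. measure (\<nu> n) (V k))"
    using F(1) sets_mball \<nu> by (intro finite_measure.finite_measure_subadditive_finite) (auto simp: V_def)
  also have "\<dots> \<le> (\<Sum>k\<in>F. A n * \<rho> k powr p')"
  proof (rule sum_mono)
    fix k show "measure (\<nu> n) (V k) \<le> A n * \<rho> k powr p'"
      unfolding V_def using \<nu>(4)[OF y(1)[of k], of "\<rho> k"] U(2)[of k] \<rho>(1)[of k] by simp
  qed
  also have "\<dots> = A n * ((\<Sum>k\<in>F. q k powr p') + \<epsilon> * (\<Sum>k\<in>F. (1 / 2) ^ Suc k))"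
    by (simp only: \<rho>(2) sum.distrib flip: sum_distrib_left)
  also have "\<dots> \<le> A n * (\<epsilon> + \<epsilon> * 1)"
  proof (intro mult_left_mono add_mono)
    have "(\<Sum>k\<in>F. q k powr p') \<le> (\<Sum>k\<in>F. q k powr p)"
      using U(2,3) p'(3) p by (intro sum_mono powr_mono') auto
    also have "\<dots> < \<epsilon>" by (rule U(5)[OF F(1)])
    finally show "(\<Sum>k\<in>F. q k powr p') \<le> \<epsilon>" by simp
    show "(\<Sum>k\<in>F. (1 / 2) ^ Suc k) \<le> (1::real)"
      using sum_le_suminf[OF sums_summable[OF power_half_series] F(1)] sums_unique[OF power_half_series]
      by simp
  qed (use A_pos[of n] \<epsilon> in auto)
  also have "\<dots> \<le> 2 * A\<^sub>0 * (\<epsilon> + \<epsilon> * 1)"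
    using A_le[of n] \<epsilon> by (intro mult_right_mono) auto
  also have "\<dots> = 1 / 2" using A0(1) by (simp add: \<epsilon>_def)
  finally show False using \<nu>(3) by simp
qed

corollary hausdorff_dim_ge:
  assumes "x\<^sub>0 \<in> M" "0 < R" "compactin mtopology S" "mball x\<^sub>0 R \<subseteq> S" "M \<inter> (\<Inter>k. T k) \<subseteq> E"
  shows "ereal s \<le> hausdorff_dim d E"
  unfolding hausdorff_dim_def
proof (rule Inf_greatest, safe)
  fix p assume "0 \<le> p" "hausdorff_measure d p E = 0"
  then show "ereal s \<le> ereal p"
    using hausdorff_measure_nonzero[OF _ _ assms, of p] by force
qed

end

section \<open>The dimensional number\<close>

text \<open>The share of one coordinate in \<open>dim_term\<close>; the branches are membership in
  K1, K2 and K3. Neighbouring branches agree at \<open>A = a\<close> and, for \<open>A\<close>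
  nonzero, at \<open>A = a + t\<close>, so the formula of an open interval of break points extends
  to its ends.\<close>

definition coord_exponent :: "real \<Rightarrow> real \<Rightarrow> real \<Rightarrow> real \<Rightarrow> real \<Rightarrow> real" where
  "coord_exponent \<delta> \<kappa> a t A =
     (if A \<le> a then \<delta> else if a + t \<le> A then \<delta> - (1 - \<kappa>) * t * \<delta> / A
      else \<kappa> * \<delta> + (1 - \<kappa>) * a * \<delta> / A)"

lemma dim_term_eq_sum:
  "dim_term d \<delta> \<kappa> a t A = (\<Sum>k<d. coord_exponent (\<delta> k) \<kappa> (a k) (t k) A)"
proof -
  define K1 where "K1 = {k\<in>{..<d}. a k \<ge> A}"
  define K2 where "K2 = {k\<in>{..<d}. a k + t k \<le> A} - K1"
  define K3 where "K3 = {..<d} - (K1 \<union> K2)"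
  have K: "{..<d} = K1 \<union> (K2 \<union> K3)" "K1 \<inter> (K2 \<union> K3) = {}" "K2 \<inter> K3 = {}" "finite K1" "finite K2" "finite K3"
    by (auto simp: K1_def K2_def K3_def)
  have K1: "coord_exponent (\<delta> k) \<kappa> (a k) (t k) A = \<delta> k" if "k \<in> K1" for k
    using that by (auto simp: K1_def coord_exponent_def)
  have K2: "coord_exponent (\<delta> k) \<kappa> (a k) (t k) A = \<delta> k - (1 - \<kappa>) / A * (t k * \<delta> k)" if "k \<in> K2" for k
    using that by (auto simp: K1_def K2_def coord_exponent_def)
  have K3: "coord_exponent (\<delta> k) \<kappa> (a k) (t k) A = \<kappa> * \<delta> k + (1 - \<kappa>) / A * (a k * \<delta> k)" if "k \<in> K3" for k
    using that by (auto simp: K1_def K2_def K3_def coord_exponent_def)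
  have "(\<Sum>k<d. coord_exponent (\<delta> k) \<kappa> (a k) (t k) A) =
      (\<Sum>k\<in>K1. \<delta> k) + ((\<Sum>k\<in>K2. \<delta> k - (1 - \<kappa>) / A * (t k * \<delta> k)) +
       (\<Sum>k\<in>K3. \<kappa> * \<delta> k + (1 - \<kappa>) / A * (a k * \<delta> k)))"
    unfolding K(1) using K(2-) by (simp add: sum.union_disjoint K1 K2 K3)
  also have "\<dots> = (\<Sum>k\<in>K1. \<delta> k) + (\<Sum>k\<in>K2. \<delta> k) + \<kappa> * (\<Sum>k\<in>K3. \<delta> k)
      + (1 - \<kappa>) / A * ((\<Sum>k\<in>K3. a k * \<delta> k) - (\<Sum>k\<in>K2. t k * \<delta> k))"
    by (simp add: sum.distrib sum_subtractf sum_distrib_left right_diff_distrib)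
  finally show ?thesis
    unfolding dim_term_def Let_def K1_def[symmetric] K2_def[symmetric] K3_def[symmetric] by simp
qed

text \<open>Between consecutive break points the exponent is affine in $1/A$, hence monotone; this is why
  only the break points enter the dimensional number.\<close>

lemma dim_number_le_dim_term:
  assumes "d \<ge> 1" "\<kappa> < 1" "0 < A"
    and pos: "\<And>k. k < d \<Longrightarrow> 0 < \<delta> k" "\<And>k. k < d \<Longrightarrow> 0 < a k" "\<And>k. k < d \<Longrightarrow> 0 < t k"
  shows "dim_number d \<delta> \<kappa> a t \<le> dim_term d \<delta> \<kappa> a t A"
proof -
  define S where "S = a ` {..<d} \<union> (\<lambda>i. a i + t i) ` {..<d}"
  let ?T = "dim_term d \<delta> \<kappa> a t"
  have S: "finite S" "\<And>k. k < d \<Longrightarrow> a k \<in> S" "\<And>k. k < d \<Longrightarrow> a k + t k \<in> S" by (auto simp: S_def)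
  have S_pos: "0 < B" if "B \<in> S" for B using that pos by (auto simp: S_def intro: add_pos_pos)
  have le: "dim_number d \<delta> \<kappa> a t \<le> ?T B" if "B \<in> S" for B
    unfolding dim_number_def S_def[symmetric] using S(1) that by simp
  show ?thesis
  proof (cases "A \<in> S")
    case False
    \<comment> \<open>\<open>P\<close> and \<open>Q\<close> freeze each branch at the position of
      \<open>A\<close>; they are the constant term and the coefficient of the reciprocal.\<close>
    define P where "P k = (if A < a k \<or> a k + t k < A then \<delta> k else \<kappa> * \<delta> k)" for k
    define Q where "Q k = (if A < a k then 0 else if a k + t k < A then - ((1 - \<kappa>) * t k * \<delta> k)
      else (1 - \<kappa>) * a k * \<delta> k)" for k
    have affine: "?T B = sum P {..<d} + sum Q {..<d} / B"
      if B: "0 < B" and between: "\<And>x. x \<in> S \<Longrightarrow> \<not> (min A B < x \<and> x < max A B)" for B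
    proof -
      have "coord_exponent (\<delta> k) \<kappa> (a k) (t k) B = P k + Q k / B" if k: "k < d" for k
      proof -
        have ne: "A \<noteq> a k" "A \<noteq> a k + t k" using False S k by auto
        have bt: "\<not> (min A B < a k \<and> a k < max A B)" "\<not> (min A B < a k + t k \<and> a k + t k < max A B)"
          using between S k by auto
        consider "A < a k" | "a k < A" "A < a k + t k" | "a k + t k < A"
          using ne by linarith
        then show ?thesis
        proof cases
          case 1
          then have "B \<le> a k" using bt by (auto simp: min_def max_def split: if_splits)
          then show ?thesis using 1 by (simp add: coord_exponent_def P_def Q_def)
        next
          case 2
          then have "a k \<le> B" "B \<le> a k + t k" using bt by (auto simp: min_def max_def split: if_splits)
          then consider "B = a k" | "B = a k + t k" | "a k < B" "B < a k + t k" by linarith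
          then show ?thesis
          proof cases
            case 1
            with 2 B show ?thesis by (simp add: coord_exponent_def P_def Q_def field_simps)
          next
            case 2
            with \<open>a k < A\<close> \<open>A < a k + t k\<close> B pos(3)[OF k] show ?thesis
              by (simp add: coord_exponent_def P_def Q_def field_simps)
          next
            case 3
            with 2 show ?thesis by (simp add: coord_exponent_def P_def Q_def)
          qed
        next
          case 3
          then have "a k + t k \<le> B" using bt by (auto simp: min_def max_def split: if_splits)
          then show ?thesis using 3 pos(3)[OF k] by (simp add: coord_exponent_def P_def Q_def)
        qed
      qed
      then show ?thesis by (simp add: dim_term_eq_sum sum.distrib sum_divide_distrib)
    qed
    have TA: "?T A = sum P {..<d} + sum Q {..<d} / A" by (rule affine) (use assms in auto)
    show ?thesis
    \<comment> \<open>The sign of the coefficient decides which neighbouring break point has the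
      smaller value: the next one above if it is nonnegative, the next one below if it is negative.
      The missing neighbour is ruled out each time: above all break points every \<open>Q k\<close>
      is negative, below all of them every \<open>Q k\<close> is 0.\<close>
    proof (cases "0 \<le> sum Q {..<d}")
      case True
      have "{B\<in>S. A < B} \<noteq> {}"
      proof
        assume "{B\<in>S. A < B} = {}"
        then have lt: "a k + t k < A" if "k < d" for k
          using S(3)[OF that] False by (metis (mono_tags, lifting) empty_iff mem_Collect_eq linorder_neqE)
        have "Q k < 0" if "k < d" for k
          using lt[OF that] pos[OF that] assms(2) by (simp add: Q_def)
        then have "sum Q {..<d} < 0" 
          using assms(1) sum_strict_mono[of "{..<d}" Q "\<lambda>_. 0"] by (auto simp: lessThan_empty_iff)
        with True show False by simp
      qed
      then have B: "Min {B\<in>S. A < B} \<in> {B\<in>S. A < B}" using S(1) by (intro Min_in) auto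
      define B where "B = Min {B\<in>S. A < B}"
      have "\<not> x < B" if "x \<in> S" "A < x" for x
        unfolding B_def using S(1) that by (simp add: not_less)
      then have "?T B = sum P {..<d} + sum Q {..<d} / B"
        using B assms(3) by (intro affine) (auto simp: B_def[symmetric])
      also have "\<dots> \<le> ?T A"
        unfolding TA using True B assms(3) by (auto simp: B_def[symmetric] intro!: divide_left_mono mult_pos_pos)
      finally show ?thesis using le[of B] B by (auto simp: B_def)
    next
      case neg: False
      have "{B\<in>S. B < A} \<noteq> {}"
      proof
        assume "{B\<in>S. B < A} = {}"
        then have lt: "A < a k" if "k < d" for k
          using S(2)[OF that] False by (metis (mono_tags, lifting) empty_iff mem_Collect_eq linorder_neqE)
        have "sum Q {..<d} = 0" using lt by (intro sum.neutral) (auto simp: Q_def)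
        with neg show False by simp
      qed
      then have B: "Max {B\<in>S. B < A} \<in> {B\<in>S. B < A}" using S(1) by (intro Max_in) auto
      define B where "B = Max {B\<in>S. B < A}"
      have B0: "0 < B" using B S_pos by (auto simp: B_def)
      have "\<not> B < x" if "x \<in> S" "x < A" for x
        unfolding B_def using S(1) that by (simp add: not_less)
      then have "?T B = sum P {..<d} + sum Q {..<d} / B"
        using B B0 by (intro affine) (auto simp: B_def[symmetric])
      also have "\<dots> \<le> ?T A"
        unfolding TA using neg B B0 by (auto simp: B_def[symmetric] intro!: divide_left_mono_neg mult_pos_pos)
      finally show ?thesis using le[of B] B by (auto simp: B_def)
    qed
  qed (rule le)
qed

text \<open>At the smallest \<open>a k\<close> every coordinate belongs to K1 and contributes its
  full \<open>\<delta> k\<close>.\<close>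

lemma dim_number_le_sum:
  assumes "d \<ge> 1" "\<And>k. k < d \<Longrightarrow> 0 < a k" "\<And>k. k < d \<Longrightarrow> 0 < t k" 
  shows "dim_number d \<delta> \<kappa> a t \<le> (\<Sum>k<d. \<delta> k)"
proof -
  let ?S = "a ` {..<d} \<union> (\<lambda>i. a i + t i) ` {..<d}"
  have ne: "a ` {..<d} \<noteq> {}" using assms(1) by (auto simp: lessThan_empty_iff)
  define A where "A = Min (a ` {..<d})"
  have "A \<in> ?S" using Min_in[OF _ ne] by (auto simp: A_def)
  then have "dim_number d \<delta> \<kappa> a t \<le> dim_term d \<delta> \<kappa> a t A"
    unfolding dim_number_def by (intro Min_le) auto
  also have "\<dots> = (\<Sum>k<d. \<delta> k)"
    unfolding dim_term_eq_sum by (intro sum.cong) (auto simp: coord_exponent_def A_def)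
  finally show ?thesis .
qed

section \<open>One coordinate\<close>

text \<open>The infimum in \<open>ereal\<close> puts the empty set at infinite distance, so no case
  distinction on \<open>E\<close> arises.\<close>

lemma Delta_eq: "Delta Xi dsti E \<epsilon> = {y \<in> Xi. \<exists>z\<in>E. dsti y z < \<epsilon>}"
  by (auto simp: Delta_def INF_less_iff)

locale resonant_space = Metric_space M d
  for M :: "'a set" and d :: "'a \<Rightarrow> 'a \<Rightarrow> real" +
  fixes N :: "'a measure" and J :: "'j set" and R :: "'j \<Rightarrow> 'a set"
    and \<delta> \<kappa> c C c\<^sub>2 c\<^sub>3 r\<^sub>0 :: real
  assumes prob: "prob_space N"
    and open_sets: "\<And>U. openin mtopology U \<Longrightarrow> U \<in> sets N"
    and R_sub: "\<And>\<alpha>. \<alpha> \<in> J \<Longrightarrow> R \<alpha> \<subseteq> M"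
    and \<delta>_pos: "0 < \<delta>" and \<kappa>: "0 \<le> \<kappa>" "\<kappa> < 1"
    and constants: "0 < c" "0 < C" "0 < c\<^sub>2" "0 < c\<^sub>3" "0 < r\<^sub>0"
    and lower: "\<And>x r. \<lbrakk>x \<in> M; 0 < r; r \<le> r\<^sub>0\<rbrakk> \<Longrightarrow> c * r powr \<delta> \<le> measure N (ball_i M d x r)"
    and upper: "\<And>x r. \<lbrakk>x \<in> M; 0 < r; r \<le> r\<^sub>0\<rbrakk> \<Longrightarrow> measure N (ball_i M d x r) \<le> C * r powr \<delta>"
    and scaling_lower: "\<And>\<alpha> x \<epsilon> r. \<lbrakk>\<alpha> \<in> J; x \<in> R \<alpha>; 0 < \<epsilon>; \<epsilon> < r; r \<le> r\<^sub>0\<rbrakk> \<Longrightarrow>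
      c\<^sub>2 * r powr (\<delta> * \<kappa>) * \<epsilon> powr (\<delta> * (1 - \<kappa>)) \<le> measure N (ball_i M d x r \<inter> Delta M d (R \<alpha>) \<epsilon>)"
    and scaling_upper: "\<And>\<alpha> x \<epsilon> r. \<lbrakk>\<alpha> \<in> J; x \<in> R \<alpha>; 0 < \<epsilon>; \<epsilon> < r; r \<le> r\<^sub>0\<rbrakk> \<Longrightarrow>
      measure N (ball_i M d x r \<inter> Delta M d (R \<alpha>) \<epsilon>) \<le> c\<^sub>3 * r powr (\<delta> * \<kappa>) * \<epsilon> powr (\<delta> * (1 - \<kappa>))"
begin

lemma openin_ball_i: "x \<in> M \<Longrightarrow> openin mtopology (ball_i M d x r)"
  using openin_mball[of x r] by (simp add: ball_i_def mball_def)

lemma openin_Delta: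
  assumes "\<alpha> \<in> J" shows "openin mtopology (Delta M d (R \<alpha>) \<epsilon>)"
proof -
  have "Delta M d (R \<alpha>) \<epsilon> = (\<Union>z\<in>R \<alpha>. mball z \<epsilon>)"
    using R_sub[OF assms] by (auto simp: Delta_eq) (metis commute subsetD)+
  then show ?thesis by auto
qed

lemma sets_ball_i: "x \<in> M \<Longrightarrow> ball_i M d x r \<in> sets N"
  by (rule open_sets[OF openin_ball_i])

lemma sets_Delta: "\<alpha> \<in> J \<Longrightarrow> Delta M d (R \<alpha>) \<epsilon> \<in> sets N"
  by (rule open_sets[OF openin_Delta])

text \<open>The lower scaling bound with both radii halved; the exponents
  \<open>\<delta> * \<kappa>\<close> and \<open>\<delta> * (1 - \<kappa>)\<close> add up to
  \<open>\<delta>\<close>, whence the factor \<open>2 powr - \<delta>\<close>. Of the remaining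
  powers, \<open>r powr (a * \<delta>)\<close> is the size of the box side and the other one is the
  proportion kept after shrinking by \<open>t\<close>.\<close>

lemma neighbourhood_mass_ge:
  fixes a t r :: real
  assumes \<alpha>: "\<alpha> \<in> J" "x \<in> R \<alpha>" and r: "0 < r" "r < 1" "r powr a \<le> r\<^sub>0" and t: "0 < t"
  shows "c\<^sub>2 * 2 powr - \<delta> * (r powr (a * \<delta>) * r powr (t * \<delta> * (1 - \<kappa>)))
     \<le> measure N (ball_i M d x (r powr a / 2) \<inter> Delta M d (R \<alpha>) (r powr (a + t) / 2))"
proof -
  have e: "r powr (a + t) < r powr a" using r t by (intro powr_less_mono') auto
  have exps: "a * (\<delta> * \<kappa>) + (a + t) * (\<delta> * (1 - \<kappa>)) = a * \<delta> + t * \<delta> * (1 - \<kappa>)"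
    "\<delta> * \<kappa> + \<delta> * (1 - \<kappa>) = \<delta>"
    by (simp_all add: algebra_simps)
  have eq: "(r powr a / 2) powr (\<delta> * \<kappa>) * (r powr (a + t) / 2) powr (\<delta> * (1 - \<kappa>))
      = 2 powr - \<delta> * (r powr (a * \<delta>) * r powr (t * \<delta> * (1 - \<kappa>)))"
    unfolding powr_divide powr_powr times_divide_times_eq powr_add[symmetric] exps
    by (simp add: powr_minus_divide)
  have "r powr a / 2 \<le> r\<^sub>0" using r(3) constants(5) by linarith
  then show ?thesis
    using scaling_lower[OF \<alpha>, of "r powr (a + t) / 2" "r powr a / 2"] e r(1) eq by (simp add: mult.assoc)
qed

text \<open>The first factor bounds the number of \<open>r powr a / 2\<close>-balls that meet a ball of radius \<open>\<rho>\<close>;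
  the three cases are those of the sets $\mathcal K_1$, $\mathcal K_2$, $\mathcal K_3$ for $\rho = r^A$.\<close>

lemma neighbourhood_mass_le:
  fixes a t r A :: real
  defines "\<rho> \<equiv> r powr A"
  assumes \<alpha>: "\<alpha> \<in> J" "x \<in> R \<alpha>" and y: "y \<in> M"
    and r: "0 < r" "r < 1" "3 * r powr a \<le> r\<^sub>0" and \<rho>: "\<rho> \<le> r\<^sub>0" and pos: "0 < a" "0 < t" "0 < A"
  shows "(C * (\<rho> + r powr a) powr \<delta>) / (c * (r powr a / 2) powr \<delta>) *
      measure N (ball_i M d x (r powr a / 2) \<inter> Delta M d (R \<alpha>) (r powr (a + t) / 2) \<inter> ball_i M d y \<rho>)
     \<le> C / c * 4 powr \<delta> * (c\<^sub>3 * 3 powr \<delta> + C) *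
        (r powr (t * \<delta> * (1 - \<kappa>)) * r powr (A * coord_exponent \<delta> \<kappa> a t A))"
    (is "?n * measure N ?S \<le> ?K * ?rhs")
proof -
  interpret prob_space N by (rule prob)
  define b where "b = r powr a"
  define e where "e = r powr (a + t)"
  have be: "0 < b" "0 < e" "e < b" and \<rho>0: "0 < \<rho>"
    using r pos by (auto simp: b_def e_def \<rho>_def intro: powr_less_mono')
  have xM: "x \<in> M" using R_sub \<alpha> by blast
  note S = sets_ball_i[OF xM] sets_ball_i[OF y] sets_Delta[OF \<alpha>(1)]
  have count: "?n \<le> C / c * (2 * (\<rho> + b) / b) powr \<delta>"
  proof -
    have "(\<rho> + b) powr \<delta> / (b / 2) powr \<delta> = ((\<rho> + b) / (b / 2)) powr \<delta>"
      by (rule powr_divide[symmetric])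
    also have "(\<rho> + b) / (b / 2) = 2 * (\<rho> + b) / b" by simp
    finally have "C / c * ((\<rho> + b) powr \<delta> / (b / 2) powr \<delta>) = C / c * (2 * (\<rho> + b) / b) powr \<delta>"
      by (rule arg_cong)
    then show ?thesis unfolding b_def[symmetric] by simp
  qed
  \<comment> \<open>One factor is to serve all three cases, whose own constants are
    \<open>c\<^sub>3\<close>, \<open>C\<close> and
    \<open>c\<^sub>3 * 3 powr \<delta>\<close>.\<close>
  have c3: "c\<^sub>3 \<le> c\<^sub>3 * 3 powr \<delta> + C"
  proof -
    have "1 \<le> (3::real) powr \<delta>" using \<delta>_pos by (intro ge_one_powr_ge_zero) auto
    then show ?thesis using constants by (simp add: add_increasing2)
  qed
  \<comment> \<open>Common shape of the cases: at most a constant times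
    \<open>z powr \<delta>\<close> balls, each contributing at most a constant times
    \<open>w\<close>.\<close>
  have combine: "?n * measure N ?S \<le> ?K * ?rhs"
    if n: "2 * (\<rho> + b) / b \<le> 4 * z" and z: "0 < z"
      and k: "measure N ?S \<le> k * w" "k \<le> c\<^sub>3 * 3 powr \<delta> + C" "0 \<le> w" and eq: "z powr \<delta> * w = ?rhs" for z k w
  proof -
    have "?n \<le> C / c * (4 * z) powr \<delta>"
      using count powr_mono2[OF _ _ n, of \<delta>] be \<rho>0 \<delta>_pos constants
      by (intro order_trans[OF count] mult_left_mono) auto
    also have "\<dots> = C / c * (4 powr \<delta> * z powr \<delta>)" using z by (simp add: powr_mult)
    finally have 1: "?n \<le> C / c * (4 powr \<delta> * z powr \<delta>)" .
    have 2: "measure N ?S \<le> (c\<^sub>3 * 3 powr \<delta> + C) * w"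
      using k by (meson mult_right_mono order_trans)
    have "?n * measure N ?S \<le> (C / c * (4 powr \<delta> * z powr \<delta>)) * ((c\<^sub>3 * 3 powr \<delta> + C) * w)"
      using 1 2 constants by (intro mult_mono) auto
    also have "\<dots> = ?K * (z powr \<delta> * w)" by simp
    finally show ?thesis unfolding eq .
  qed
  have small_b: "b / 2 \<le> r\<^sub>0" using r be by (simp add: b_def[symmetric])
  consider "A \<le> a" | "a < A" "a + t \<le> A" | "a < A" "A < a + t" by linarith
  then show ?thesis
  proof cases
    case 1
    \<comment> \<open>The ball contains many boxes, and each is charged with the mass of its whole
      neighbourhood.\<close>
    have "b \<le> \<rho>" unfolding b_def \<rho>_def using 1 r by (intro powr_mono') auto
    show ?thesis
    proof (rule combine[of "r powr (A - a)" c\<^sub>3 "r powr (a * \<delta>) * r powr (t * \<delta> * (1 - \<kappa>))"])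
      have "\<rho> / b = r powr (A - a)" by (simp add: \<rho>_def b_def powr_diff)
      moreover have "2 * (\<rho> + b) / b \<le> 4 * (\<rho> / b)" using \<open>b \<le> \<rho>\<close> be by (simp add: field_simps)
      ultimately show "2 * (\<rho> + b) / b \<le> 4 * r powr (A - a)" by simp
      have "measure N ?S \<le> measure N (ball_i M d x (b / 2) \<inter> Delta M d (R \<alpha>) (e / 2))"
        unfolding b_def e_def using S by (intro finite_measure_mono) auto
      also have "\<dots> \<le> c\<^sub>3 * (b / 2) powr (\<delta> * \<kappa>) * (e / 2) powr (\<delta> * (1 - \<kappa>))"
        using be small_b by (intro scaling_upper \<alpha>) auto
      also have "\<dots> \<le> c\<^sub>3 * b powr (\<delta> * \<kappa>) * e powr (\<delta> * (1 - \<kappa>))"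
        using be constants \<delta>_pos \<kappa> by (intro mult_mono powr_mono2 mult_nonneg_nonneg) auto
      also have "\<dots> = c\<^sub>3 * (r powr (a * \<delta>) * r powr (t * \<delta> * (1 - \<kappa>)))"
      proof -
        have "b powr (\<delta> * \<kappa>) * e powr (\<delta> * (1 - \<kappa>)) = r powr (a * \<delta>) * r powr (t * \<delta> * (1 - \<kappa>))"
          unfolding b_def e_def powr_powr powr_add[symmetric]
          by (rule arg_cong[where f = "(powr) r"]) (simp add: algebra_simps)
        then show ?thesis by (simp only: mult.assoc)
      qed
      finally show "measure N ?S \<le> c\<^sub>3 * (r powr (a * \<delta>) * r powr (t * \<delta> * (1 - \<kappa>)))" .
      show "(r powr (A - a)) powr \<delta> * (r powr (a * \<delta>) * r powr (t * \<delta> * (1 - \<kappa>))) = ?rhs"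
      proof -
        have "coord_exponent \<delta> \<kappa> a t A = \<delta>" using 1 by (simp add: coord_exponent_def)
        then show ?thesis
          unfolding powr_powr powr_add[symmetric] by (intro arg_cong[where f = "(powr) r"]) (simp add: algebra_simps)
      qed
    qed (use c3 r in auto)
  next
    case 2
    \<comment> \<open>The ball is no wider than the neighbourhood: the count is bounded, and the
      mass of the ball itself is the right bound.\<close>
    have "\<rho> \<le> b" unfolding b_def \<rho>_def using 2 r by (intro powr_mono') auto
    show ?thesis
    proof (rule combine[of 1 C "\<rho> powr \<delta>"])
      have "measure N ?S \<le> measure N (ball_i M d y \<rho>)"
        using S by (intro finite_measure_mono) auto
      also have "\<dots> \<le> C * \<rho> powr \<delta>" by (rule upper) (use y \<rho> \<rho>0 in auto)
      finally show "measure N ?S \<le> C * \<rho> powr \<delta>" .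
      have "A * (\<delta> - (1 - \<kappa>) * t * \<delta> / A) = A * \<delta> - t * \<delta> * (1 - \<kappa>)"
        using pos by (simp add: field_simps)
      then have "A * coord_exponent \<delta> \<kappa> a t A = A * \<delta> - t * \<delta> * (1 - \<kappa>)"
        using 2 by (simp add: coord_exponent_def)
      then show "1 powr \<delta> * \<rho> powr \<delta> = ?rhs"
        unfolding \<rho>_def powr_powr powr_one_eq_one mult_1_left powr_add[symmetric]
        by (intro arg_cong[where f = "(powr) r"]) simp
    qed (use \<open>\<rho> \<le> b\<close> be constants in \<open>auto simp: field_simps\<close>)
  next
    case 3
    have \<rho>b: "\<rho> \<le> b" "e \<le> \<rho>" unfolding b_def \<rho>_def e_def using 3 r by (auto intro!: powr_mono')
    show ?thesis
    proof (rule combine[of 1 "c\<^sub>3 * 3 powr \<delta>" "\<rho> powr (\<delta> * \<kappa>) * e powr (\<delta> * (1 - \<kappa>))"])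
      show "measure N ?S \<le> c\<^sub>3 * 3 powr \<delta> * (\<rho> powr (\<delta> * \<kappa>) * e powr (\<delta> * (1 - \<kappa>)))"
      proof (cases "?S = {}")
        case False
        \<comment> \<open>The scaling property speaks only of balls centred on the resonant set, so
          the centre moves from \<open>y\<close> to a resonant point \<open>x'\<close>; the
          distances \<open>e / 2\<close>, \<open>\<rho>\<close> and \<open>\<rho>\<close> fit into
          the radius \<open>3 * \<rho>\<close>. This radius is at most \<open>3 * r powr a\<close>,
          hence the assumption on it.\<close>
        then obtain z x' where z: "z \<in> M" "d y z < \<rho>" "x' \<in> R \<alpha>" "d z x' < e / 2"
          unfolding e_def by (auto simp: ball_i_def Delta_eq)
        have x': "x' \<in> M" using R_sub \<alpha> z by blast
        have "?S \<subseteq> ball_i M d x' (3 * \<rho>) \<inter> Delta M d (R \<alpha>) (e / 2)"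
        proof
          fix w assume w: "w \<in> ?S"
          then have "w \<in> M" "d y w < \<rho>" by (auto simp: ball_i_def)
          then have "d x' w < 3 * \<rho>"
            using triangle[of x' z w] triangle[of z y w] z x' y \<rho>b be commute[of x' z] commute[of z y] by simp
          with w \<open>w \<in> M\<close> show "w \<in> ball_i M d x' (3 * \<rho>) \<inter> Delta M d (R \<alpha>) (e / 2)"
            by (auto simp: ball_i_def e_def)
        qed
        then have "measure N ?S \<le> measure N (ball_i M d x' (3 * \<rho>) \<inter> Delta M d (R \<alpha>) (e / 2))"
          using S sets_ball_i[OF x'] by (intro finite_measure_mono) auto
        also have "\<dots> \<le> c\<^sub>3 * (3 * \<rho>) powr (\<delta> * \<kappa>) * (e / 2) powr (\<delta> * (1 - \<kappa>))"
          using be \<rho>b \<rho>0 r by (intro scaling_upper \<alpha> z) (auto simp: b_def)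
        also have "\<dots> \<le> c\<^sub>3 * (3 powr \<delta> * \<rho> powr (\<delta> * \<kappa>)) * e powr (\<delta> * (1 - \<kappa>))"
        proof (intro mult_mono mult_nonneg_nonneg)
          have "(3::real) powr (\<delta> * \<kappa>) \<le> 3 powr \<delta>"
            using \<delta>_pos \<kappa> by (intro powr_mono) (auto simp: mult_le_cancel_left1)
          then show "(3 * \<rho>) powr (\<delta> * \<kappa>) \<le> 3 powr \<delta> * \<rho> powr (\<delta> * \<kappa>)"
            using \<rho>0 by (simp add: powr_mult mult_right_mono)
          show "(e / 2) powr (\<delta> * (1 - \<kappa>)) \<le> e powr (\<delta> * (1 - \<kappa>))"
            using be \<delta>_pos \<kappa> by (intro powr_mono2) auto
        qed (use constants in auto)
        finally show ?thesis by (simp add: mult.assoc)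
      qed (use constants in auto)
      have "A * (\<kappa> * \<delta> + (1 - \<kappa>) * a * \<delta> / A) = A * \<kappa> * \<delta> + (1 - \<kappa>) * a * \<delta>"
        using pos by (simp add: field_simps)
      then have "A * coord_exponent \<delta> \<kappa> a t A = A * \<kappa> * \<delta> + (1 - \<kappa>) * a * \<delta>"
        using 3 by (simp add: coord_exponent_def)
      then show "1 powr \<delta> * (\<rho> powr (\<delta> * \<kappa>) * e powr (\<delta> * (1 - \<kappa>))) = ?rhs"
        unfolding \<rho>_def e_def powr_powr powr_one_eq_one mult_1_left powr_add[symmetric]
        by (intro arg_cong[where f = "(powr) r"]) (simp add: algebra_simps)
    qed (use \<rho>b be constants in \<open>auto simp: field_simps\<close>)
  qed
qed

end

section \<open>Products\<close>

lemma measure_PiM_PiE: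
  assumes "finite I" "I \<noteq> {}" "\<And>i. i \<in> I \<Longrightarrow> prob_space (m i)" "\<And>i. i \<in> I \<Longrightarrow> A i \<in> sets (m i)"
  shows "measure (PiM I m) (PiE I A) = (\<Prod>i\<in>I. measure (m i) (A i))"
proof -
  obtain j where j: "j \<in> I" using assms(2) by blast
  \<comment> \<open>The product locale speaks of all indices, so the family is filled up outside
    \<open>I\<close> with a probability space already present; the product over \<open>I\<close>
    does not change.\<close>
  define m' where "m' i = (if i \<in> I then m i else m j)" for i
  have p: "prob_space (m' i)" for i using assms(3) j by (simp add: m'_def)
  then interpret finite_product_prob_space m' I
    by (intro finite_product_prob_space.intro finite_product_sigma_finite.intro product_prob_space.intro
        product_sigma_finite.intro finite_product_sigma_finite_axioms.intro product_prob_space_axioms.intro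
        prob_space_imp_sigma_finite assms)
  have "measure (PiM I m') (PiE I A) = (\<Prod>i\<in>I. measure (m' i) (A i))"
    by (rule prob_times) (use assms in \<open>auto simp: m'_def\<close>)
  moreover have "PiM I m' = PiM I m" by (rule PiM_cong) (auto simp: m'_def)
  ultimately show ?thesis by (simp add: m'_def)
qed

lemma prod_dist_less_iff:
  assumes "1 \<le> d" shows "prod_dist d dst x y < r \<longleftrightarrow> (\<forall>i<d. dst i (x i) (y i) < r)"
  unfolding prod_dist_def using assms by (subst Max_less_iff) (auto simp: lessThan_empty_iff)

lemma prod_dist_le_iff:
  assumes "1 \<le> d" shows "prod_dist d dst x y \<le> r \<longleftrightarrow> (\<forall>i<d. dst i (x i) (y i) \<le> r)"
  unfolding prod_dist_def using assms by (subst Max_le_iff) (auto simp: lessThan_empty_iff)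

lemma Metric_space_prod_dist:
  assumes d: "1 \<le> d" and X: "\<And>i. i < d \<Longrightarrow> Metric_space (X i) (dst i)"
  shows "Metric_space (PiE {..<d} X) (prod_dist d dst)"
proof
  have ge: "dst i (x i) (y i) \<le> prod_dist d dst x y" if "i < d" for i x y
    using prod_dist_le_iff[OF d, of dst x y "prod_dist d dst x y"] that by simp
  have d0: "0 < d" using d by simp
  show nonneg: "0 \<le> prod_dist d dst x y" for x y
    using ge[OF d0, of x y] Metric_space.nonneg[OF X[OF d0], of "x 0" "y 0"] by linarith
  show "prod_dist d dst x y = prod_dist d dst y x" for x y
    unfolding prod_dist_def by (intro arg_cong[where f = Max] image_cong) (auto simp: Metric_space.commute[OF X])
  show "prod_dist d dst x y = 0 \<longleftrightarrow> x = y" if xy: "x \<in> PiE {..<d} X" "y \<in> PiE {..<d} X" for x y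
  proof -
    have "prod_dist d dst x y = 0 \<longleftrightarrow> prod_dist d dst x y \<le> 0" using nonneg[of x y] by linarith
    also have "\<dots> \<longleftrightarrow> (\<forall>i<d. x i = y i)"
      unfolding prod_dist_le_iff[OF d]
    proof (intro all_cong1 imp_cong refl)
      fix i assume i: "i < d"
      interpret Metric_space "X i" "dst i" by (rule X[OF i])
      have "x i \<in> X i" "y i \<in> X i" using xy i by auto
      then show "dst i (x i) (y i) \<le> 0 \<longleftrightarrow> x i = y i"
        using nonneg[of "x i" "y i"] zero[of "x i" "y i"] by linarith
    qed
    also have "\<dots> \<longleftrightarrow> x = y" using xy by (auto intro: PiE_ext)
    finally show ?thesis .
  qed
  show "prod_dist d dst x z \<le> prod_dist d dst x y + prod_dist d dst y z"
    if xyz: "x \<in> PiE {..<d} X" "y \<in> PiE {..<d} X" "z \<in> PiE {..<d} X" for x y z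
    unfolding prod_dist_le_iff[OF d]
  proof (intro allI impI)
    fix i assume i: "i < d"
    have "dst i (x i) (z i) \<le> dst i (x i) (y i) + dst i (y i) (z i)"
      by (rule Metric_space.triangle[OF X[OF i]]) (use xyz i in auto)
    with ge[OF i, of x y] ge[OF i, of y z] show "dst i (x i) (z i) \<le> prod_dist d dst x y + prod_dist d dst y z"
      by linarith
  qed
qed

lemma ball_X_eq_mball:
  assumes "1 \<le> d" "\<And>i. i < d \<Longrightarrow> Metric_space (X i) (dst i)" "x \<in> PiE {..<d} X"
  shows "ball_X d X dst x r = Metric_space.mball (PiE {..<d} X) (prod_dist d dst) x r"
proof -
  interpret Metric_space "PiE {..<d} X" "prod_dist d dst"
    by (rule Metric_space_prod_dist[OF assms(1,2)])
  show ?thesis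
    unfolding mball_def ball_X_def ball_i_def prod_dist_less_iff[OF assms(1)]
    using assms(3) by (auto simp: PiE_iff extensional_def)
qed

lemma openin_prod_dist_PiE:
  assumes d: "1 \<le> d" and X: "\<And>i. i < d \<Longrightarrow> Metric_space (X i) (dst i)"
    and U: "\<And>i. i < d \<Longrightarrow> openin (Metric_space.mtopology (X i) (dst i)) (U i)"
  shows "openin (Metric_space.mtopology (PiE {..<d} X) (prod_dist d dst)) (PiE {..<d} U)"
proof -
  interpret Metric_space "PiE {..<d} X" "prod_dist d dst"
    by (rule Metric_space_prod_dist[OF d X])
  have UX: "U i \<subseteq> X i" if "i < d" for i
    using openin_subset[OF U[OF that]] Metric_space.topspace_mtopology[OF X[OF that]] by simp
  show ?thesis
    unfolding openin_mtopology
  proof (intro conjI allI impI)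
    show "PiE {..<d} U \<subseteq> PiE {..<d} X" using UX by (intro PiE_mono) auto
    fix z assume z: "z \<in> PiE {..<d} U"
    have "\<exists>e>0. \<forall>w\<in>X i. dst i (z i) w < e \<longrightarrow> w \<in> U i" if i: "i < d" for i
    proof -
      have "z i \<in> U i" using z i by auto
      then obtain e where "e > 0" "Metric_space.mball (X i) (dst i) (z i) e \<subseteq> U i"
        using U[OF i] unfolding Metric_space.openin_mtopology[OF X[OF i]] by blast
      moreover have "z i \<in> X i" using UX[OF i] \<open>z i \<in> U i\<close> by blast
      ultimately show ?thesis
        unfolding Metric_space.mball_def[OF X[OF i]] by blast
    qed
    then obtain e where e: "\<And>i. i < d \<Longrightarrow> e i > 0" "\<And>i w. i < d \<Longrightarrow> w \<in> X i \<Longrightarrow> dst i (z i) w < e i \<Longrightarrow> w \<in> U i"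
      by metis
    define \<eta> where "\<eta> = Min (e ` {..<d})"
    have ne: "e ` {..<d} \<noteq> {}" using d by (auto simp: lessThan_empty_iff)
    have \<eta>: "0 < \<eta>" "\<And>i. i < d \<Longrightarrow> \<eta> \<le> e i"
      unfolding \<eta>_def using ne e(1) by (auto simp: Min_gr_iff)
    have "mball z \<eta> \<subseteq> PiE {..<d} U"
    proof
      fix w assume w: "w \<in> mball z \<eta>"
      then have wX: "w \<in> PiE {..<d} X" and wd: "\<And>i. i < d \<Longrightarrow> dst i (z i) (w i) < \<eta>"
        by (auto simp: prod_dist_less_iff[OF d])
      show "w \<in> PiE {..<d} U"
      proof (rule PiE_I)
        fix i assume "i \<in> {..<d}"
        then have i: "i < d" by simp
        show "w i \<in> U i" using e(2)[OF i, of "w i"] wd[OF i] \<eta>(2)[OF i] wX i by auto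
      qed (use wX in auto)
    qed
    with \<eta>(1) show "\<exists>r>0. mball z r \<subseteq> PiE {..<d} U" by blast
  qed
qed

text \<open>Tychonoff gives compactness in the product topology. It passes to the metric topology
  because every metrically open set is open in the product topology; only that inclusion
  enters.\<close>

lemma compactin_prod_dist_PiE:
  assumes d: "1 \<le> d" and X: "\<And>i. i < d \<Longrightarrow> Metric_space (X i) (dst i)"
    and S: "\<And>i. i < d \<Longrightarrow> compactin (Metric_space.mtopology (X i) (dst i)) (S i)"
  shows "compactin (Metric_space.mtopology (PiE {..<d} X) (prod_dist d dst)) (PiE {..<d} S)"
proof -
  interpret Metric_space "PiE {..<d} X" "prod_dist d dst"
    by (rule Metric_space_prod_dist[OF d X])
  define T where "T i = Metric_space.mtopology (X i) (dst i)" for i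
  let ?P = "product_topology T {..<d}"
  have top: "topspace (T i) = X i" if "i < d" for i
    unfolding T_def by (rule Metric_space.topspace_mtopology[OF X[OF that]])
  have cpt: "compactin ?P (PiE {..<d} S)"
    unfolding compactin_PiE using S by (auto simp: T_def)
  have coarser: "openin ?P U" if U: "openin mtopology U" for U
  proof (subst openin_subopen, intro ballI)
    fix x assume x: "x \<in> U"
    have xX: "x \<in> PiE {..<d} X" using openin_subset[OF U] x by auto
    from U x obtain r where r: "r > 0" "mball x r \<subseteq> U"
      unfolding openin_mtopology by blast
    have "ball_X d X dst x r = PiE {..<d} (\<lambda>i. Metric_space.mball (X i) (dst i) (x i) r)"
      unfolding ball_X_def
    proof (rule PiE_cong)
      fix i assume "i \<in> {..<d}"
      then have i: "i < d" "x i \<in> X i" using xX by auto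
      show "ball_i (X i) (dst i) (x i) r = Metric_space.mball (X i) (dst i) (x i) r"
        unfolding Metric_space.mball_def[OF X[OF i(1)]] ball_i_def using i(2) by simp
    qed
    moreover have "openin ?P (PiE {..<d} (\<lambda>i. Metric_space.mball (X i) (dst i) (x i) r))"
      unfolding openin_PiE[OF finite_lessThan] T_def using Metric_space.openin_mball[OF X] by blast
    ultimately have "openin ?P (mball x r)"
      using ball_X_eq_mball[OF d X xX, of r] by simp
    moreover have "x \<in> mball x r" using xX r by simp
    ultimately show "\<exists>V. openin ?P V \<and> x \<in> V \<and> V \<subseteq> U" using r by blast
  qed
  have top: "topspace ?P = PiE {..<d} X"
    unfolding topspace_product_topology by (rule PiE_cong) (simp add: top)
  show ?thesis
    unfolding compactin_def topspace_mtopology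
  proof (intro conjI allI impI)
    show "PiE {..<d} S \<subseteq> PiE {..<d} X" using compactin_subset_topspace[OF cpt] top by simp
    fix \<U> assume \<U>: "(\<forall>U\<in>\<U>. openin mtopology U) \<and> PiE {..<d} S \<subseteq> \<Union>\<U>"
    then have "\<And>U. U \<in> \<U> \<Longrightarrow> openin ?P U" using coarser by blast
    from compactinD[OF cpt this] \<U>
    show "\<exists>\<F>. finite \<F> \<and> \<F> \<subseteq> \<U> \<and> PiE {..<d} S \<subseteq> \<Union>\<F>" by simp
  qed
qed

section \<open>The local mass estimate for rectangles\<close>

locale rectangle_system =
  fixes d :: nat and X :: "nat \<Rightarrow> 'a set" and dst :: "nat \<Rightarrow> 'a \<Rightarrow> 'a \<Rightarrow> real"
    and m :: "nat \<Rightarrow> 'a measure" and J :: "'j set" and R :: "'j \<Rightarrow> nat \<Rightarrow> 'a set"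
    and \<delta> c C c\<^sub>2 c\<^sub>3 a t :: "nat \<Rightarrow> real" and \<kappa> r\<^sub>0 :: real
  assumes d: "1 \<le> d"
    and coord: "\<And>i. i < d \<Longrightarrow> resonant_space (X i) (dst i) (m i) J (\<lambda>\<alpha>. R \<alpha> i) (\<delta> i) \<kappa> (c i) (C i) (c\<^sub>2 i) (c\<^sub>3 i) r\<^sub>0"
    and a_pos: "\<And>i. i < d \<Longrightarrow> 0 < a i" and t_pos: "\<And>i. i < d \<Longrightarrow> 0 < t i"
begin

abbreviation "XX \<equiv> PiE {..<d} X"
abbreviation "P \<equiv> PiM {..<d} m"
abbreviation "dim_no \<equiv> dim_number d \<delta> \<kappa> a t"

lemma metric: "i < d \<Longrightarrow> Metric_space (X i) (dst i)"
  using coord unfolding resonant_space_def by blast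

sublocale Prod: Metric_space XX "prod_dist d dst"
  by (rule Metric_space_prod_dist[OF d metric])

lemma finite_P: "finite_measure P"
  using prob_space_PiM[of "{..<d}" m] resonant_space.prob[OF coord] prob_space_def by blast

lemma sets_box: "(\<And>i. i < d \<Longrightarrow> A i \<in> sets (m i)) \<Longrightarrow> PiE {..<d} A \<in> sets P"
  by (rule sets_PiM_I_finite) auto

lemma measure_box: "(\<And>i. i < d \<Longrightarrow> A i \<in> sets (m i)) \<Longrightarrow> measure P (PiE {..<d} A) = (\<Prod>i<d. measure (m i) (A i))"
  by (rule measure_PiM_PiE) (use d resonant_space.prob[OF coord] in \<open>auto simp: lessThan_empty_iff\<close>)

lemma ball_X_mball: "x \<in> XX \<Longrightarrow> ball_X d X dst x r = Prod.mball x r"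
  by (rule ball_X_eq_mball[OF d metric])

lemma sets_ball_X: "x \<in> XX \<Longrightarrow> ball_X d X dst x r \<in> sets P"
  unfolding ball_X_def by (intro sets_box resonant_space.sets_ball_i[OF coord]) auto

lemma measure_ball_X_le:
  assumes "x \<in> XX" "\<And>i. i < d \<Longrightarrow> 0 < r i \<and> r i \<le> r\<^sub>0"
  shows "measure P (PiE {..<d} (\<lambda>i. ball_i (X i) (dst i) (x i) (r i))) \<le> (\<Prod>i<d. C i * r i powr \<delta> i)"
proof -
  have x: "x i \<in> X i" if "i < d" for i using assms(1) that by auto
  have "measure P (PiE {..<d} (\<lambda>i. ball_i (X i) (dst i) (x i) (r i))) =
      (\<Prod>i<d. measure (m i) (ball_i (X i) (dst i) (x i) (r i)))"
    by (intro measure_box resonant_space.sets_ball_i[OF coord] x)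
  also have "\<dots> \<le> (\<Prod>i<d. C i * r i powr \<delta> i)"
    using assms(2) x by (intro prod_mono) (auto intro: resonant_space.upper[OF coord])
  finally show ?thesis .
qed

lemma measure_ball_X_ge:
  assumes "x \<in> XX" "\<And>i. i < d \<Longrightarrow> 0 < r i \<and> r i \<le> r\<^sub>0"
  shows "(\<Prod>i<d. c i * r i powr \<delta> i) \<le> measure P (PiE {..<d} (\<lambda>i. ball_i (X i) (dst i) (x i) (r i)))"
proof -
  have x: "x i \<in> X i" if "i < d" for i using assms(1) that by auto
  have "(\<Prod>i<d. c i * r i powr \<delta> i) \<le> (\<Prod>i<d. measure (m i) (ball_i (X i) (dst i) (x i) (r i)))"
    using assms(2) x resonant_space.constants[OF coord]
    by (intro prod_mono) (auto intro: resonant_space.lower[OF coord] simp: less_imp_le)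
  also have "\<dots> = measure P (PiE {..<d} (\<lambda>i. ball_i (X i) (dst i) (x i) (r i)))"
    by (intro measure_box[symmetric] resonant_space.sets_ball_i[OF coord] x)
  finally show ?thesis .
qed

text \<open>The product of the coordinatewise constants of
  \<open>neighbourhood_mass_le\<close>.\<close>

definition K_upper :: real where
  "K_upper = (\<Prod>i<d. C i / c i * 4 powr \<delta> i * (c\<^sub>3 i * 3 powr \<delta> i + C i))"

text \<open>Per coordinate: the lower volume constant of a ball of radius \<open>\<xi> / 2\<close>,
  times the constant of \<open>neighbourhood_mass_ge\<close>, over the upper volume constant of a
  box of doubled radius.\<close>

definition K_lower :: real where
  "K_lower = (\<Prod>i<d. c i * (1 / 2) powr \<delta> i * (c\<^sub>2 i * 2 powr - \<delta> i) / (C i * 2 powr \<delta> i))"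

lemma K_pos: "0 < K_upper" "0 < K_lower"
  unfolding K_upper_def K_lower_def using resonant_space.constants[OF coord]
  by (auto intro!: prod_pos divide_pos_pos mult_pos_pos add_pos_pos)

text \<open>Here the dimensional number has to be compared with \<open>dim_term\<close> at an
  arbitrary positive \<open>A\<close>, as \<open>A\<close> encodes an arbitrary radius
  \<open>r powr A\<close>. The inequality flips because \<open>r < 1\<close>.\<close>

lemma prod_powr_coord_exponent_le:
  assumes r: "0 < r" "r < 1" and A: "0 < A"
  shows "(\<Prod>i<d. r powr (A * coord_exponent (\<delta> i) \<kappa> (a i) (t i) A)) \<le> (r powr A) powr dim_no"
proof -
  have "(\<Prod>i<d. r powr (A * coord_exponent (\<delta> i) \<kappa> (a i) (t i) A)) = r powr (A * dim_term d \<delta> \<kappa> a t A)"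
    unfolding dim_term_eq_sum sum_distrib_left using r by (subst powr_sum) auto
  also have "\<dots> \<le> r powr (A * dim_no)"
  proof -
    have "dim_no \<le> dim_term d \<delta> \<kappa> a t A"
      by (rule dim_number_le_dim_term) (use d A a_pos t_pos resonant_space.\<delta>_pos[OF coord]
          resonant_space.\<kappa>[OF coord[of 0]] in auto)
    then show ?thesis using r A by (intro powr_mono') auto
  qed
  finally show ?thesis by (simp add: powr_powr)
qed

text \<open>\<open>big\<close> is ubiquity at a single level. Volume comparison turns it into many
  disjoint boxes, hence a lower bound for \<open>measure P G\<close>; the same comparison limits how
  many boxes a small ball meets. In the quotient of the two bounds all dependence on
  \<open>r\<close> cancels.\<close>

lemma local_mass:
  fixes r \<xi> \<theta> :: real
  assumes r: "0 < r" "r < 1" "\<forall>i<d. 8 * r powr a i \<le> \<xi>" and \<xi>: "0 < \<xi>" "\<xi> \<le> r\<^sub>0"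
    and x0: "x\<^sub>0 \<in> XX" and J': "J' \<subseteq> J" and \<theta>: "0 < \<theta>"
    and big: "\<theta> * measure P (ball_X d X dst x\<^sub>0 (\<xi> / 2))
      \<le> measure P (ball_X d X dst x\<^sub>0 (\<xi> / 2) \<inter> (\<Union>\<alpha>\<in>J'. Delta_rect d X dst (R \<alpha>) r a))"
  shows "\<exists>G\<in>sets P. openin Prod.mtopology G \<and> 0 < measure P G \<and>
     (\<exists>\<eta>>0. \<forall>g\<in>G. Prod.mball g \<eta> \<subseteq> Prod.mball x\<^sub>0 \<xi> \<inter> (\<Union>\<alpha>\<in>J'. Delta_rect d X dst (R \<alpha>) r (\<lambda>i. a i + t i))) \<and>
     (\<forall>y\<in>XX. \<forall>\<rho>. 0 < \<rho> \<and> \<rho> \<le> min r\<^sub>0 1 / 2 \<longrightarrow>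
        measure P (G \<inter> Prod.mball y \<rho>) \<le> K_upper / (\<theta> * K_lower) * \<rho> powr dim_no * measure P G / \<xi> powr sum \<delta> {..<d})"
proof -
  interpret P: finite_measure P by (rule finite_P)
  define b where "b i = r powr a i" for i
  define e where "e i = r powr (a i + t i)" for i
  have be: "0 < b i" "0 < e i" "e i < b i" "8 * b i \<le> \<xi>" if "i < d" for i
    using r a_pos[OF that] t_pos[OF that] that
    by (auto simp: b_def e_def intro: powr_less_mono')
  have b_ne: "b i \<noteq> 0" for i using r(1) by (simp add: b_def)
  define B' where "B' = ball_X d X dst x\<^sub>0 (\<xi> / 2)"
  \<comment> \<open>Candidate centres lie on the resonant sets, where the scaling property applies,
    and therefore only close to \<open>B'\<close> instead of inside it.\<close>
  define S where "S = {x. \<exists>\<alpha>\<in>J'. (\<forall>i<d. x i \<in> R \<alpha> i) \<and> x \<in> XX \<and> (\<exists>z\<in>B'. \<forall>i<d. dst i (z i) (x i) < b i)}"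
  have SX: "x \<in> XX" if "x \<in> S" for x using that by (auto simp: S_def)
  have SXi: "x i \<in> X i" if "x \<in> S" "i < d" for x i using SX[OF that(1)] that(2) by auto
  \<comment> \<open>Nearness has a different scale in each coordinate. Points that are not near are
    at least \<open>b i\<close> apart in some coordinate, which already separates their boxes of
    radii \<open>b i / 2\<close>.\<close>
  define near where "near x y \<longleftrightarrow> (\<forall>i<d. dst i (x i) (y i) < b i)" for x y
  define Q where "Q x = PiE {..<d} (\<lambda>i. ball_i (X i) (dst i) (x i) (b i / 2))" for x
  have Qsets: "Q x \<in> sets P" if "x \<in> S" for x
    unfolding Q_def using SXi[OF that] by (intro sets_box resonant_space.sets_ball_i[OF coord])
  have half: "0 < b i / 2 \<and> b i / 2 \<le> r\<^sub>0" if "i < d" for i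
    using be[OF that] \<xi> by auto
  define q where "q = (\<Prod>i<d. c i * (b i / 2) powr \<delta> i)"
  have q: "0 < q" unfolding q_def using resonant_space.constants[OF coord] b_ne by (auto intro!: prod_pos)
  have Qge: "q \<le> measure P (Q x)" if "x \<in> S" for x
    unfolding Q_def q_def using half by (intro measure_ball_X_ge SX[OF that])
  have Qdisj: "disjoint_family_on Q Z" if Z: "Z \<subseteq> S" "pairwise (\<lambda>x y. \<not> near x y) Z" for Z
    unfolding disjoint_family_on_def
  proof (intro ballI impI)
    fix x y assume xy: "x \<in> Z" "y \<in> Z" "x \<noteq> y"
    then obtain i where i: "i < d" "\<not> dst i (x i) (y i) < b i"
      using Z(2) unfolding pairwise_def near_def by blast
    show "Q x \<inter> Q y = {}"
    proof (rule ccontr)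
      assume "Q x \<inter> Q y \<noteq> {}"
      then obtain w where "w \<in> Q x" "w \<in> Q y" by blast
      then have w: "w i \<in> ball_i (X i) (dst i) (x i) (b i / 2)" "w i \<in> ball_i (X i) (dst i) (y i) (b i / 2)"
        unfolding Q_def using i(1) by auto
      interpret Xi: Metric_space "X i" "dst i" by (rule metric[OF i(1)])
      have "x i \<in> X i" "y i \<in> X i" using SXi xy Z(1) i(1) by auto
      then show False
        using w i(2) Xi.triangle[of "x i" "w i" "y i"] Xi.commute[of "w i" "y i"] by (auto simp: ball_i_def)
    qed
  qed
  obtain Z where Z: "finite Z" "Z \<subseteq> S" "pairwise (\<lambda>x y. \<not> near x y) Z" "\<And>x. x \<in> S \<Longrightarrow> \<exists>z\<in>Z. near x z"
  proof (rule maximal_separated_subset[where P = S and near = near and n = "nat \<lceil>measure P (space P) / q\<rceil>"])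
    show "near x x" if "x \<in> S" for x
      unfolding near_def
    proof (intro allI impI)
      fix i assume i: "i < d"
      interpret Xi: Metric_space "X i" "dst i" by (rule metric[OF i])
      show "dst i (x i) (x i) < b i" using SXi[OF that i] be[OF i] by simp
    qed
    show "near x y \<Longrightarrow> near y x" for x y
      unfolding near_def using Metric_space.commute[OF metric] by metis
    fix Z assume Z: "finite Z" "Z \<subseteq> S" "pairwise (\<lambda>x y. \<not> near x y) Z"
    have "real (card Z) * q \<le> measure P (space P)"
    proof (rule card_mult_le_measure[OF finite_P Z(1) Qdisj[OF Z(2,3)]])
      show "Q z \<in> sets P" if "z \<in> Z" for z using Qsets that Z(2) by blast
      then show "Q z \<subseteq> space P" if "z \<in> Z" for z using sets.sets_into_space that by blast
      show "q \<le> measure P (Q z)" if "z \<in> Z" for z using Qge that Z(2) by blast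
    qed auto
    then have "real (card Z) \<le> measure P (space P) / q"
      using q by (simp add: pos_le_divide_eq)
    then show "card Z \<le> nat \<lceil>measure P (space P) / q\<rceil>" by linarith
  qed (rule that)
  have ZS: "z \<in> S" if "z \<in> Z" for z using that Z(2) by blast
  have "\<exists>\<alpha>. \<alpha> \<in> J' \<and> (\<forall>i<d. z i \<in> R \<alpha> i)" if "z \<in> Z" for z
    using ZS[OF that] unfolding S_def by blast
  then obtain al where al: "\<And>z. z \<in> Z \<Longrightarrow> al z \<in> J'" "\<And>z i. z \<in> Z \<Longrightarrow> i < d \<Longrightarrow> z i \<in> R (al z) i"
    by metis
  have alJ: "al z \<in> J" if "z \<in> Z" for z using al(1) J' that by blast
  define g where "g z i = ball_i (X i) (dst i) (z i) (b i / 2) \<inter> Delta (X i) (dst i) (R (al z) i) (e i / 2)" for z i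
  define Gz where "Gz z = PiE {..<d} (g z)" for z
  have g_open: "openin (Metric_space.mtopology (X i) (dst i)) (g z i)" if "z \<in> Z" "i < d" for z i
    unfolding g_def using SXi[OF ZS[OF that(1)] that(2)] alJ[OF that(1)]
    by (intro openin_Int resonant_space.openin_ball_i[OF coord] resonant_space.openin_Delta[OF coord] that(2))
  have g_sets: "g z i \<in> sets (m i)" if "z \<in> Z" "i < d" for z i
    by (rule resonant_space.open_sets[OF coord g_open]) (use that in auto)
  have GzQ: "Gz z \<subseteq> Q z" for z
    unfolding Gz_def Q_def g_def by (intro PiE_mono) auto
  have Gz_sets: "Gz z \<in> sets P" if "z \<in> Z" for z
    unfolding Gz_def using g_sets[OF that] by (intro sets_box)
  define G where "G = (\<Union>z\<in>Z. Gz z)"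
  have G_sets: "G \<in> sets P" unfolding G_def using Z(1) Gz_sets by (intro sets.finite_UN) auto
  have G_open: "openin Prod.mtopology G"
    unfolding G_def Gz_def using g_open by (intro openin_Union) (auto intro!: openin_prod_dist_PiE[OF d metric])

  \<comment> \<open>The proportion of a box kept by the smaller neighbourhoods. It occurs as a
    factor in both the lower bound for \<open>G\<close> and the upper bound on balls, and cancels at
    the end.\<close>
  define H where "H = (\<Prod>i<d. r powr (t i * \<delta> i * (1 - \<kappa>)))"
  have H: "0 < H" unfolding H_def using r by (intro prod_pos) auto
  define h where "h = (\<Prod>i<d. c\<^sub>2 i * 2 powr - \<delta> i * (r powr (a i * \<delta> i) * r powr (t i * \<delta> i * (1 - \<kappa>))))"
  have h: "0 < h" unfolding h_def using resonant_space.constants[OF coord] r by (auto intro!: prod_pos)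
  have Gz_ge: "h \<le> measure P (Gz z)" if z: "z \<in> Z" for z
  proof -
    have "h \<le> (\<Prod>i<d. measure (m i) (g z i))"
      unfolding h_def
    proof (intro prod_mono conjI)
      fix i assume "i \<in> {..<d}"
      then have i: "i < d" by simp
      interpret Xi: resonant_space "X i" "dst i" "m i" J "\<lambda>\<alpha>. R \<alpha> i" "\<delta> i" \<kappa> "c i" "C i" "c\<^sub>2 i" "c\<^sub>3 i" r\<^sub>0
        by (rule coord[OF i])
      show "0 \<le> c\<^sub>2 i * 2 powr - \<delta> i * (r powr (a i * \<delta> i) * r powr (t i * \<delta> i * (1 - \<kappa>)))"
        using Xi.constants by simp
      show "c\<^sub>2 i * 2 powr - \<delta> i * (r powr (a i * \<delta> i) * r powr (t i * \<delta> i * (1 - \<kappa>))) \<le> measure (m i) (g z i)"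
        unfolding g_def b_def e_def
        using alJ[OF z] al(2)[OF z i] r(1,2) be[OF i] \<xi> t_pos[OF i]
        by (intro Xi.neighbourhood_mass_ge) (auto simp: b_def)
    qed
    also have "\<dots> = measure P (Gz z)" unfolding Gz_def by (rule measure_box[symmetric]) (rule g_sets[OF z])
    finally show ?thesis .
  qed
  have G_ge_card: "real (card Z) * h \<le> measure P G"
  proof (rule card_mult_le_measure[OF finite_P Z(1)])
    show "disjoint_family_on Gz Z"
      using Qdisj[OF Z(2,3)] GzQ unfolding disjoint_family_on_def by blast
  qed (use G_sets Gz_sets Gz_ge in \<open>auto simp: G_def\<close>)
  have card_ge: "\<theta> * (\<Prod>i<d. c i * (\<xi> / 2) powr \<delta> i) \<le> real (card Z) * (\<Prod>i<d. C i * (2 * b i) powr \<delta> i)"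
  proof -
    \<comment> \<open>Radii are doubled because a point of the ubiquity set is within
      \<open>b i\<close> of a point of \<open>S\<close>, which by maximality is within
      \<open>b i\<close> of a centre.\<close>
    define V where "V z = PiE {..<d} (\<lambda>i. ball_i (X i) (dst i) (z i) (2 * b i))" for z
    have V_sets: "V z \<in> sets P" if "z \<in> Z" for z
      unfolding V_def using SXi[OF ZS[OF that]] by (intro sets_box resonant_space.sets_ball_i[OF coord])
    have cover: "B' \<inter> (\<Union>\<alpha>\<in>J'. Delta_rect d X dst (R \<alpha>) r a) \<subseteq> (\<Union>z\<in>Z. V z)"
    proof
      fix w assume w: "w \<in> B' \<inter> (\<Union>\<alpha>\<in>J'. Delta_rect d X dst (R \<alpha>) r a)"
      then obtain \<alpha> where \<alpha>: "\<alpha> \<in> J'" "w \<in> Delta_rect d X dst (R \<alpha>) r a" and wB: "w \<in> B'" by blast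
      have wX: "w i \<in> X i" if "i < d" for i
        using \<alpha>(2) that unfolding Delta_rect_def Delta_eq by auto
      have "\<exists>x. x \<in> R \<alpha> i \<and> dst i (w i) x < b i" if "i < d" for i
        using \<alpha>(2) that unfolding Delta_rect_def Delta_eq b_def by auto
      then obtain x where x: "\<And>i. i < d \<Longrightarrow> x i \<in> R \<alpha> i" "\<And>i. i < d \<Longrightarrow> dst i (w i) (x i) < b i"
        by metis
      define x' where "x' = restrict x {..<d}"
      have x'eq: "x' i = x i" if "i < d" for i using that by (simp add: x'_def)
      have x'X: "x' i \<in> X i" if "i < d" for i
        using resonant_space.R_sub[OF coord[OF that], of \<alpha>] x(1)[OF that] \<alpha>(1) J' x'eq[OF that] by auto
      have "x' \<in> XX" using x'X unfolding x'_def by auto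
      then have "x' \<in> S"
        unfolding S_def using \<alpha>(1) wB x x'eq by auto
      then obtain z where z: "z \<in> Z" "near x' z" using Z(4) by blast
      have "w \<in> V z"
        unfolding V_def
      proof (rule PiE_I)
        fix i assume "i \<in> {..<d}"
        then have i: "i < d" by simp
        interpret Xi: Metric_space "X i" "dst i" by (rule metric[OF i])
        have "dst i (z i) (w i) \<le> dst i (z i) (x' i) + dst i (x' i) (w i)"
          using Xi.triangle SXi[OF ZS[OF z(1)] i] x'X[OF i] wX[OF i] by blast
        moreover have "dst i (z i) (x' i) < b i" "dst i (x' i) (w i) < b i"
          using z(2) i x(2)[OF i] x'eq[OF i] Xi.commute by (auto simp: near_def)
        ultimately show "w i \<in> ball_i (X i) (dst i) (z i) (2 * b i)"
          using wX[OF i] by (simp add: ball_i_def)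
      next
        fix i assume "i \<notin> {..<d}"
        then show "w i = undefined" using \<alpha>(2) unfolding Delta_rect_def by (rule PiE_arb[rotated])
      qed
      with z(1) show "w \<in> (\<Union>z\<in>Z. V z)" by blast
    qed
    have "\<theta> * (\<Prod>i<d. c i * (\<xi> / 2) powr \<delta> i) \<le> \<theta> * measure P B'"
      unfolding B'_def ball_X_def using \<theta> \<xi> by (intro mult_left_mono measure_ball_X_ge x0) auto
    also have "\<dots> \<le> measure P (B' \<inter> (\<Union>\<alpha>\<in>J'. Delta_rect d X dst (R \<alpha>) r a))"
      using big unfolding B'_def .
    also have "\<dots> \<le> measure P (\<Union>z\<in>Z. V z)"
      using V_sets Z(1) by (intro P.finite_measure_mono cover) auto
    also have "\<dots> \<le> (\<Sum>z\<in>Z. measure P (V z))"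
      using V_sets Z(1) by (intro P.finite_measure_subadditive_finite) auto
    also have "\<dots> \<le> (\<Sum>z\<in>Z. (\<Prod>i<d. C i * (2 * b i) powr \<delta> i))"
    proof (rule sum_mono)
      fix z assume "z \<in> Z"
      have "0 < 2 * b i \<and> 2 * b i \<le> r\<^sub>0" if "i < d" for i using be[OF that] \<xi> by auto
      then show "measure P (V z) \<le> (\<Prod>i<d. C i * (2 * b i) powr \<delta> i)"
        unfolding V_def using SX[OF ZS[OF \<open>z \<in> Z\<close>]] by (intro measure_ball_X_le)
    qed
    finally show ?thesis by simp
  qed
  have G_ge: "\<theta> * K_lower * H * \<xi> powr sum \<delta> {..<d} \<le> measure P G"
  proof -
    \<comment> \<open>Multiplying by \<open>W\<close> avoids divisions. The powers
      \<open>b i powr \<delta> i\<close> in \<open>W\<close> match the factors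
      \<open>r powr (a i * \<delta> i)\<close> in \<open>h\<close>, so the level \<open>r\<close>
      survives only through \<open>H\<close>.\<close>
    define W where "W = (\<Prod>i<d. C i * (2 * b i) powr \<delta> i)"
    have W: "0 < W" unfolding W_def using resonant_space.constants[OF coord] b_ne by (auto intro!: prod_pos)
    have "K_lower * H * \<xi> powr sum \<delta> {..<d} * W = (\<Prod>i<d. c i * (\<xi> / 2) powr \<delta> i) * h"
    proof -
      have "\<xi> powr sum \<delta> {..<d} = (\<Prod>i<d. \<xi> powr \<delta> i)" using \<xi> by (simp add: powr_sum)
      then have "K_lower * H * \<xi> powr sum \<delta> {..<d} * W =
        (\<Prod>i<d. c i * (1 / 2) powr \<delta> i * (c\<^sub>2 i * 2 powr - \<delta> i) / (C i * 2 powr \<delta> i)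
            * r powr (t i * \<delta> i * (1 - \<kappa>)) * \<xi> powr \<delta> i * (C i * (2 * b i) powr \<delta> i))"
        unfolding K_lower_def H_def W_def by (simp only: prod.distrib)
      also have "\<dots> = (\<Prod>i<d. c i * (\<xi> / 2) powr \<delta> i *
          (c\<^sub>2 i * 2 powr - \<delta> i * (r powr (a i * \<delta> i) * r powr (t i * \<delta> i * (1 - \<kappa>)))))"
      proof (rule prod.cong[OF refl])
        fix i assume "i \<in> {..<d}"
        then have i: "i < d" by simp
        have "(2 * b i) powr \<delta> i = 2 powr \<delta> i * r powr (a i * \<delta> i)"
          using r by (simp add: powr_mult b_def powr_powr)
        moreover have "(\<xi> / 2) powr \<delta> i = (1 / 2) powr \<delta> i * \<xi> powr \<delta> i"
          by (simp add: powr_divide)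
        moreover have "C i \<noteq> 0" using resonant_space.constants[OF coord[OF i]] by auto
        ultimately show "c i * (1 / 2) powr \<delta> i * (c\<^sub>2 i * 2 powr - \<delta> i) / (C i * 2 powr \<delta> i)
            * r powr (t i * \<delta> i * (1 - \<kappa>)) * \<xi> powr \<delta> i * (C i * (2 * b i) powr \<delta> i) =
          c i * (\<xi> / 2) powr \<delta> i * (c\<^sub>2 i * 2 powr - \<delta> i * (r powr (a i * \<delta> i) * r powr (t i * \<delta> i * (1 - \<kappa>))))"
          by simp
      qed
      finally show ?thesis unfolding h_def by (simp only: prod.distrib)
    qed
    then have "\<theta> * K_lower * H * \<xi> powr sum \<delta> {..<d} * W = \<theta> * (\<Prod>i<d. c i * (\<xi> / 2) powr \<delta> i) * h"
      by (simp add: mult.assoc)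
    also have "\<dots> \<le> real (card Z) * W * h"
      unfolding W_def using card_ge h by (intro mult_right_mono) auto
    also have "\<dots> = real (card Z) * h * W" by simp
    also have "\<dots> \<le> measure P G * W" using G_ge_card W by (intro mult_right_mono) auto
    finally show ?thesis using W by simp
  qed
  have G_pos: "0 < measure P G"
    using G_ge \<theta> K_pos(2) H \<xi> by (intro less_le_trans[OF _ G_ge]) auto

  have upper: "measure P (G \<inter> Prod.mball y \<rho>) \<le> K_upper * H * \<rho> powr dim_no"
    if y: "y \<in> XX" and \<rho>: "0 < \<rho>" "\<rho> \<le> min r\<^sub>0 1 / 2" for y \<rho>
  proof -
    \<comment> \<open>The exponent with \<open>r powr A = \<rho>\<close>; it is positive because
      \<open>\<rho>\<close> and \<open>r\<close> are both below 1.\<close>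
    define A where "A = ln \<rho> / ln r"
    have A: "0 < A" unfolding A_def using r \<rho> by (intro divide_neg_neg) auto
    have rA: "r powr A = \<rho>" using r \<rho> by (simp add: A_def powr_def)
    have yi: "y i \<in> X i" if "i < d" for i using y that by auto
    define B where "B i = ball_i (X i) (dst i) (y i) \<rho>" for i
    have B: "Prod.mball y \<rho> = PiE {..<d} B"
      unfolding ball_X_mball[OF y, symmetric] ball_X_def B_def ..
    have B_sets: "B i \<in> sets (m i)" if "i < d" for i
      unfolding B_def by (rule resonant_space.sets_ball_i[OF coord[OF that] yi[OF that]])
    \<comment> \<open>The product of the \<open>n i\<close> is the volume bound of the box of radii
      \<open>\<rho> + b i\<close> over that of one \<open>Q z\<close>, hence a bound on the number
      of boxes met. The restriction of \<open>\<rho>\<close> to half of \<open>r\<^sub>0\<close>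
      keeps \<open>\<rho> + b i\<close> within \<open>r\<^sub>0\<close>.\<close>
    define n where "n i = (C i * (\<rho> + b i) powr \<delta> i) / (c i * (b i / 2) powr \<delta> i)" for i
    define k where "k i = C i / c i * 4 powr \<delta> i * (c\<^sub>3 i * 3 powr \<delta> i + C i)" for i
    define u where "u i = r powr (t i * \<delta> i * (1 - \<kappa>)) * r powr (A * coord_exponent (\<delta> i) \<kappa> (a i) (t i) A)" for i
    have n_pos: "0 < n i" if "i < d" for i
      unfolding n_def using resonant_space.constants[OF coord[OF that]] be[OF that] \<rho> by simp
    define T where "T = {z \<in> Z. Gz z \<inter> PiE {..<d} B \<noteq> {}}"
    have T: "finite T" "T \<subseteq> Z" using Z(1) by (auto simp: T_def)
    have card_T: "real (card T) \<le> (\<Prod>i<d. n i)"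
    proof -
      define V where "V = PiE {..<d} (\<lambda>i. ball_i (X i) (dst i) (y i) (\<rho> + b i))"
      have "real (card T) * q \<le> measure P V"
      proof (rule card_mult_le_measure[OF finite_P T(1)])
        show "disjoint_family_on Q T"
          using Qdisj[OF Z(2,3)] T(2) by (rule disjoint_family_on_mono[rotated])
        show "V \<in> sets P"
          unfolding V_def using yi by (intro sets_box resonant_space.sets_ball_i[OF coord])
        show "Q z \<in> sets P" "q \<le> measure P (Q z)" if "z \<in> T" for z
          using Qsets Qge ZS T(2) that by blast+
        show "Q z \<subseteq> V" if zT: "z \<in> T" for z
        proof -
          have zZ: "z \<in> Z" using zT T(2) by blast
          obtain w where w: "w \<in> Gz z" "w \<in> PiE {..<d} B" using zT unfolding T_def by blast
          show ?thesis
            unfolding Q_def V_def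
          proof (intro PiE_mono subsetI)
            fix i v assume "i \<in> {..<d}" and v: "v \<in> ball_i (X i) (dst i) (z i) (b i / 2)"
            then have i: "i < d" by simp
            interpret Xi: Metric_space "X i" "dst i" by (rule metric[OF i])
            have zi: "z i \<in> X i" by (rule SXi[OF ZS[OF zZ] i])
            have wi: "w i \<in> ball_i (X i) (dst i) (z i) (b i / 2)" "w i \<in> B i"
              using w GzQ[of z] i by (auto simp: Q_def)
            show "v \<in> ball_i (X i) (dst i) (y i) (\<rho> + b i)"
              using v wi zi yi[OF i] Xi.triangle[of "y i" "w i" v] Xi.triangle[of "w i" "z i" v] Xi.commute[of "w i" "z i"]
              by (auto simp: ball_i_def B_def)
          qed
        qed
      qed
      also have "measure P V \<le> (\<Prod>i<d. C i * (\<rho> + b i) powr \<delta> i)"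
      proof -
        have "0 < \<rho> + b i \<and> \<rho> + b i \<le> r\<^sub>0" if "i < d" for i
          using be[OF that] \<rho> \<xi> by (auto intro: add_pos_pos)
        then show ?thesis unfolding V_def by (intro measure_ball_X_le y)
      qed
      finally have "real (card T) \<le> (\<Prod>i<d. C i * (\<rho> + b i) powr \<delta> i) / q"
        using q by (simp add: pos_le_divide_eq)
      then show ?thesis unfolding q_def n_def by (simp add: prod_dividef)
    qed
    \<comment> \<open>The count is available only as a product over coordinates, so the mass of one
      piece is written over that product: each \<open>n i\<close> then meets its own coordinate, as
      \<open>neighbourhood_mass_le\<close> expects.\<close>
    have each: "measure P (Gz z \<inter> PiE {..<d} B) \<le> (\<Prod>i<d. k i * u i) / (\<Prod>i<d. n i)" if z: "z \<in> Z" for z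
    proof -
      have "measure P (Gz z \<inter> PiE {..<d} B) = (\<Prod>i<d. measure (m i) (g z i \<inter> B i))"
        unfolding Gz_def PiE_Int using g_sets[OF z] B_sets by (intro measure_box) auto
      then have "(\<Prod>i<d. n i) * measure P (Gz z \<inter> PiE {..<d} B) = (\<Prod>i<d. n i * measure (m i) (g z i \<inter> B i))"
        by (simp add: prod.distrib)
      also have "\<dots> \<le> (\<Prod>i<d. k i * u i)"
      proof (intro prod_mono conjI)
        fix i assume "i \<in> {..<d}"
        then have i: "i < d" by simp
        show "0 \<le> n i * measure (m i) (g z i \<inter> B i)" using n_pos[OF i] by simp
        interpret Xi: resonant_space "X i" "dst i" "m i" J "\<lambda>\<alpha>. R \<alpha> i" "\<delta> i" \<kappa> "c i" "C i" "c\<^sub>2 i" "c\<^sub>3 i" r\<^sub>0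
          by (rule coord[OF i])
        show "n i * measure (m i) (g z i \<inter> B i) \<le> k i * u i"
          unfolding n_def k_def u_def g_def B_def b_def e_def rA[symmetric]
          using alJ[OF z] al(2)[OF z i] yi[OF i] r(1,2) be[OF i] \<xi> \<rho> a_pos[OF i] t_pos[OF i] A
          by (intro Xi.neighbourhood_mass_le) (auto simp: b_def rA)
      qed
      finally show ?thesis
        using prod_pos[of "{..<d}" n] n_pos by (simp add: pos_le_divide_eq mult.commute)
    qed
    have N0: "0 < (\<Prod>i<d. n i)" using n_pos by (intro prod_pos) auto
    have ku: "0 \<le> (\<Prod>i<d. k i * u i)"
      unfolding k_def u_def using resonant_space.constants[OF coord]
      by (intro prod_nonneg) (auto intro!: mult_nonneg_nonneg add_nonneg_nonneg simp: less_imp_le)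
    have "G \<inter> Prod.mball y \<rho> = (\<Union>z\<in>T. Gz z \<inter> PiE {..<d} B)"
      unfolding B G_def T_def by blast
    moreover have "measure P (\<Union>z\<in>T. Gz z \<inter> PiE {..<d} B) \<le> (\<Sum>z\<in>T. measure P (Gz z \<inter> PiE {..<d} B))"
    proof (rule P.finite_measure_subadditive_finite[OF T(1)])
      have "Gz z \<inter> PiE {..<d} B \<in> sets P" if "z \<in> T" for z
        using Gz_sets sets_box[OF B_sets] T(2) that by blast
      then show "(\<lambda>z. Gz z \<inter> PiE {..<d} B) ` T \<subseteq> sets P" by blast
    qed
    ultimately have "measure P (G \<inter> Prod.mball y \<rho>) \<le> (\<Sum>z\<in>T. measure P (Gz z \<inter> PiE {..<d} B))"
      by simp
    also have "\<dots> \<le> (\<Sum>z\<in>T. (\<Prod>i<d. k i * u i) / (\<Prod>i<d. n i))"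
      using T(2) each by (intro sum_mono) auto
    also have "\<dots> = real (card T) * ((\<Prod>i<d. k i * u i) / (\<Prod>i<d. n i))" by simp
    also have "\<dots> \<le> (\<Prod>i<d. n i) * ((\<Prod>i<d. k i * u i) / (\<Prod>i<d. n i))"
      using card_T N0 ku by (intro mult_right_mono) auto
    also have "\<dots> = (\<Prod>i<d. k i * u i)" by (simp only: times_divide_eq_right nonzero_mult_div_cancel_left[OF less_imp_neq[OF N0, symmetric]])
    also have "\<dots> = K_upper * H * (\<Prod>i<d. r powr (A * coord_exponent (\<delta> i) \<kappa> (a i) (t i) A))"
      unfolding k_def u_def K_upper_def H_def by (simp only: prod.distrib mult.assoc)
    also have "\<dots> \<le> K_upper * H * (r powr A) powr dim_no"
      using K_pos(1) H r A by (intro mult_left_mono prod_powr_coord_exponent_le) auto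
    finally show ?thesis by (simp only: rA)
  qed

  \<comment> \<open>\<open>e i / 2\<close> is the room left by the halved neighbourhoods. With
    \<open>8 * b i \<le> \<xi>\<close>, the distances from \<open>x\<^sub>0\<close> add up to less
    than \<open>\<xi> / 2 + \<xi> / 8 + \<xi> / 16 + \<xi> / 16\<close>, which is below
    \<open>\<xi>\<close>.\<close>
  define \<eta> where "\<eta> = Min (insert (\<xi> / 16) ((\<lambda>i. e i / 2) ` {..<d}))"
  have \<eta>: "0 < \<eta>" unfolding \<eta>_def using be \<xi> by (subst Min_gr_iff) auto
  have \<eta>le: "\<eta> \<le> \<xi> / 16" "\<And>i. i < d \<Longrightarrow> \<eta> \<le> e i / 2"
    unfolding \<eta>_def by (rule Min_le; force)+
  have nbhd: "Prod.mball w \<eta> \<subseteq> Prod.mball x\<^sub>0 \<xi> \<inter> (\<Union>\<alpha>\<in>J'. Delta_rect d X dst (R \<alpha>) r (\<lambda>i. a i + t i))"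
    if w: "w \<in> G" for w
  proof
    fix v assume v: "v \<in> Prod.mball w \<eta>"
    obtain z where z: "z \<in> Z" "w \<in> Gz z" using w by (auto simp: G_def)
    obtain z0 where z0: "z0 \<in> B'" "\<And>i. i < d \<Longrightarrow> dst i (z0 i) (z i) < b i"
      using ZS[OF z(1)] unfolding S_def by blast
    have vX: "v \<in> XX" and vw: "\<And>i. i < d \<Longrightarrow> dst i (w i) (v i) < \<eta>"
      using v by (auto simp: prod_dist_less_iff[OF d])
    have "dst i (x\<^sub>0 i) (v i) < \<xi> \<and> (\<exists>x\<in>R (al z) i. dst i (v i) x < e i)" if i: "i < d" for i
    proof -
      interpret Xi: Metric_space "X i" "dst i" by (rule metric[OF i])
      have wg: "w i \<in> g z i" using z(2) i by (auto simp: Gz_def)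
      then obtain x where x: "x \<in> R (al z) i" "dst i (w i) x < e i / 2" by (auto simp: g_def Delta_eq)
      have xX: "x \<in> X i" using x resonant_space.R_sub[OF coord[OF i] alJ[OF z(1)]] by auto
      have mem: "x\<^sub>0 i \<in> X i" "v i \<in> X i" "w i \<in> X i" "z i \<in> X i" "z0 i \<in> X i"
        using x0 vX wg SXi[OF ZS[OF z(1)] i] z0(1) i by (auto simp: g_def ball_i_def B'_def ball_X_def PiE_iff)
      have dist: "dst i (x\<^sub>0 i) (z0 i) < \<xi> / 2" "dst i (z i) (w i) < b i / 2"
        using z0(1) wg i by (auto simp: g_def ball_i_def B'_def ball_X_def PiE_iff)
      have "dst i (x\<^sub>0 i) (v i) \<le> dst i (x\<^sub>0 i) (z0 i) + dst i (z0 i) (z i) + dst i (z i) (w i) + dst i (w i) (v i)"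
        using Xi.triangle[of "x\<^sub>0 i" "z0 i" "v i"] Xi.triangle[of "z0 i" "z i" "v i"] Xi.triangle[of "z i" "w i" "v i"] mem
        by linarith
      also have "\<dots> < \<xi>" using dist z0(2)[OF i] vw[OF i] \<eta>le(1) be(4)[OF i] \<xi> by linarith
      finally have 1: "dst i (x\<^sub>0 i) (v i) < \<xi>" .
      have "dst i (v i) x \<le> dst i (w i) (v i) + dst i (w i) x"
        using Xi.triangle[of "v i" "w i" x] Xi.commute[of "v i" "w i"] mem xX by simp
      also have "\<dots> < e i" using x(2) vw[OF i] \<eta>le(2)[OF i] by linarith
      finally show ?thesis using 1 x(1) by blast
    qed
    then have "v \<in> Prod.mball x\<^sub>0 \<xi>" "v \<in> Delta_rect d X dst (R (al z)) r (\<lambda>i. a i + t i)"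
      using vX x0 by (auto simp: prod_dist_less_iff[OF d] Delta_rect_def Delta_eq e_def PiE_iff)
    then show "v \<in> Prod.mball x\<^sub>0 \<xi> \<inter> (\<Union>\<alpha>\<in>J'. Delta_rect d X dst (R \<alpha>) r (\<lambda>i. a i + t i))"
      using al(1)[OF z(1)] by blast
  qed
  have final: "measure P (G \<inter> Prod.mball y \<rho>) \<le> K_upper / (\<theta> * K_lower) * \<rho> powr dim_no * measure P G / \<xi> powr sum \<delta> {..<d}"
    if "y \<in> XX" "0 < \<rho>" "\<rho> \<le> min r\<^sub>0 1 / 2" for y \<rho>
  proof -
    have "H \<le> measure P G / (\<theta> * K_lower * \<xi> powr sum \<delta> {..<d})"
      using G_ge \<theta> K_pos(2) \<xi> by (simp add: pos_le_divide_eq mult_ac)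
    then have "K_upper * H * \<rho> powr dim_no \<le> K_upper * (measure P G / (\<theta> * K_lower * \<xi> powr sum \<delta> {..<d})) * \<rho> powr dim_no"
      using K_pos(1) by (intro mult_right_mono mult_left_mono) auto
    with upper[OF that] show ?thesis by (simp add: mult_ac)
  qed
  show ?thesis
    using G_sets G_open G_pos \<eta> nbhd final by blast
qed

end

section \<open>Assembly: from ubiquity to the transfer locale\<close>

lemma finite_common_radius:
  fixes r :: "nat \<Rightarrow> real"
  assumes "\<And>i. i < d \<Longrightarrow> 0 < r i"
  obtains R where "0 < R" "\<And>i. i < d \<Longrightarrow> R \<le> r i"
proof (rule that[of "Min (insert 1 (r ` {..<d}))"])
  show "0 < Min (insert 1 (r ` {..<d}))" using assms by (subst Min_gr_iff) auto
qed auto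

text \<open>A limsup of at least \<open>\<theta>\<close> times the ball measure guarantees
  infinitely many good levels only for a smaller constant, hence \<open>\<theta> / 2\<close>. Having
  infinitely many allows a level beyond \<open>k\<close> at which all \<open>r n powr a i\<close>
  are already small compared with \<open>\<xi>\<close>.\<close>

lemma (in rectangle_system) ahlfors_transfer_rectangles:
  fixes r :: "nat \<Rightarrow> real" and I :: "nat \<Rightarrow> 'j set"
  assumes I: "\<And>n. I n \<subseteq> J"
    and r_pos: "\<forall>\<^sub>F n in sequentially. 0 < r n" and r_lim: "r \<longlonglongrightarrow> 0"
    and \<theta>: "0 < \<theta>"
    and ubiq: "\<And>x s. x \<in> XX \<Longrightarrow> 0 < s \<Longrightarrow>
      limsup (\<lambda>n. ereal (measure P (ball_X d X dst x s \<inter> (\<Union>\<alpha>\<in>I n. Delta_rect d X dst (R \<alpha>) (r n) a))))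
        \<ge> ereal (\<theta> * measure P (ball_X d X dst x s))"
  shows "ahlfors_transfer XX (prod_dist d dst) P
    (\<lambda>k. \<Union>n\<in>{k..}. \<Union>\<alpha>\<in>I n. Delta_rect d X dst (R \<alpha>) (r n) (\<lambda>i. a i + t i))
    (sum \<delta> {..<d}) dim_no (\<Prod>i<d. c i) (\<Prod>i<d. C i) (K_upper / (\<theta> / 2 * K_lower)) (min r\<^sub>0 1 / 2)"
proof (intro ahlfors_transfer.intro ahlfors_transfer_axioms.intro Prod.Metric_space_axioms finite_P)
  have r0: "0 < r\<^sub>0" using resonant_space.constants[OF coord[of 0]] d by simp
  then show "0 < min r\<^sub>0 1 / 2" by simp
  show "Prod.mball x s \<in> sets P" for x s
  proof (cases "x \<in> XX")
    case True
    then show ?thesis using sets_ball_X[OF True] ball_X_mball[OF True] by simp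
  next
    case False
    then have "Prod.mball x s = {}" by auto
    then show ?thesis by simp
  qed
  show "0 < (\<Prod>i<d. c i)" "0 < (\<Prod>i<d. C i)"
    using resonant_space.constants[OF coord] by (auto intro!: prod_pos)
  show "0 < K_upper / (\<theta> / 2 * K_lower)" using K_pos \<theta> by simp
  show "dim_no \<le> sum \<delta> {..<d}" by (rule dim_number_le_sum) (use d a_pos t_pos in auto)
  have powr_D: "(\<Prod>i<d. z i * s powr \<delta> i) = (\<Prod>i<d. z i) * s powr sum \<delta> {..<d}" if "0 < s" for z s
    using that by (simp add: prod.distrib powr_sum)
  show "(\<Prod>i<d. c i) * s powr sum \<delta> {..<d} \<le> measure P (Prod.mball x s)"
    if "x \<in> XX" "0 < s" "s \<le> min r\<^sub>0 1 / 2" for x s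
    using measure_ball_X_ge[of x "\<lambda>_. s"] that r0 powr_D[of s c] ball_X_mball[of x s] by (simp add: ball_X_def)
  show "measure P (Prod.mball x s) \<le> (\<Prod>i<d. C i) * s powr sum \<delta> {..<d}"
    if "x \<in> XX" "0 < s" "s \<le> min r\<^sub>0 1 / 2" for x s
    using measure_ball_X_le[of x "\<lambda>_. s"] that r0 powr_D[of s C] ball_X_mball[of x s] by (simp add: ball_X_def)
  fix x \<xi> k assume x: "x \<in> XX" and \<xi>: "0 < \<xi>" "\<xi> \<le> min r\<^sub>0 1 / 2"
  let ?B = "ball_X d X dst x (\<xi> / 2)"
  let ?f = "\<lambda>n. measure P (ball_X d X dst x (\<xi> / 2) \<inter> (\<Union>\<alpha>\<in>I n. Delta_rect d X dst (R \<alpha>) (r n) a))"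
  have "0 < (\<Prod>i<d. c i * (\<xi> / 2) powr \<delta> i)"
    using resonant_space.constants[OF coord] \<xi> by (auto intro!: prod_pos)
  also have "\<dots> \<le> measure P ?B"
    unfolding ball_X_def by (rule measure_ball_X_ge[OF x]) (use \<xi> r0 in auto)
  finally have B0: "0 < measure P ?B" .
  have "\<exists>\<^sub>F n in sequentially. \<theta> / 2 * measure P ?B \<le> ?f n"
  proof (rule ccontr)
    assume "\<not> (\<exists>\<^sub>F n in sequentially. \<theta> / 2 * measure P ?B \<le> ?f n)"
    then have "\<forall>\<^sub>F n in sequentially. ereal (?f n) \<le> ereal (\<theta> / 2 * measure P ?B)"
      unfolding not_frequently by eventually_elim simp
    then have "limsup (\<lambda>n. ereal (?f n)) \<le> ereal (\<theta> / 2 * measure P ?B)"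
      by (rule Limsup_bounded)
    with ubiq[OF x, of "\<xi> / 2"] \<xi> have "ereal (\<theta> * measure P ?B) \<le> ereal (\<theta> / 2 * measure P ?B)"
      by (meson half_gt_zero order_trans)
    then show False using \<theta> B0 by simp
  qed
  moreover have "\<forall>\<^sub>F n in sequentially. k \<le> n \<and> 0 < r n \<and> r n < 1 \<and> (\<forall>i\<in>{..<d}. 8 * r n powr a i \<le> \<xi>)"
  proof (intro eventually_conj eventually_ge_at_top r_pos eventually_ball_finite ballI)
    show "\<forall>\<^sub>F n in sequentially. r n < 1" using order_tendstoD(2)[OF r_lim, of 1] by simp
    fix i assume "i \<in> {..<d}"
    then have "0 < a i" using a_pos by simp
    then obtain s where s: "0 < s" "\<And>z. 0 < z \<Longrightarrow> z \<le> s \<Longrightarrow> 8 * z powr a i < \<xi>"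
      using ex_small_powr[of "a i" \<xi> 8] \<xi>(1) by blast
    show "\<forall>\<^sub>F n in sequentially. 8 * r n powr a i \<le> \<xi>"
      using order_tendstoD(2)[OF r_lim s(1)] r_pos by eventually_elim (use s(2) in \<open>auto simp: less_imp_le\<close>)
  qed auto
  ultimately have "\<exists>\<^sub>F n in sequentially.
      (k \<le> n \<and> 0 < r n \<and> r n < 1 \<and> (\<forall>i\<in>{..<d}. 8 * r n powr a i \<le> \<xi>)) \<and> \<theta> / 2 * measure P ?B \<le> ?f n"
    by (rule frequently_eventually_conj)
  then obtain n where n: "\<theta> / 2 * measure P ?B \<le> ?f n" "k \<le> n" "0 < r n" "r n < 1"
      "\<forall>i<d. 8 * r n powr a i \<le> \<xi>"
    using frequently_ex by fastforce
  have "\<xi> \<le> r\<^sub>0" "0 < \<theta> / 2" using \<xi> \<theta> by simp_all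
  from local_mass[OF n(3,4,5) \<xi>(1) this(1) x I[of n] this(2) n(1)]
  obtain G where G: "G \<in> sets P" "openin Prod.mtopology G" "0 < measure P G"
     "\<exists>\<eta>>0. \<forall>g\<in>G. Prod.mball g \<eta> \<subseteq> Prod.mball x \<xi> \<inter> (\<Union>\<alpha>\<in>I n. Delta_rect d X dst (R \<alpha>) (r n) (\<lambda>i. a i + t i))"
     "\<forall>y\<in>XX. \<forall>s. 0 < s \<and> s \<le> min r\<^sub>0 1 / 2 \<longrightarrow>
        measure P (G \<inter> Prod.mball y s) \<le> K_upper / (\<theta> / 2 * K_lower) * s powr dim_no * measure P G / \<xi> powr sum \<delta> {..<d}"
    by (elim bexE conjE) (rule that)
  have "\<exists>\<eta>>0. \<forall>g\<in>G. Prod.mball g \<eta> \<subseteq> Prod.mball x \<xi> \<inter>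
      (\<Union>n\<in>{k..}. \<Union>\<alpha>\<in>I n. Delta_rect d X dst (R \<alpha>) (r n) (\<lambda>i. a i + t i))"
  proof -
    obtain \<eta> where \<eta>: "0 < \<eta>" "\<forall>g\<in>G. Prod.mball g \<eta> \<subseteq> Prod.mball x \<xi> \<inter> (\<Union>\<alpha>\<in>I n. Delta_rect d X dst (R \<alpha>) (r n) (\<lambda>i. a i + t i))"
      using G(4) by (elim exE conjE) (rule that)
    have "n \<in> {k..}" using n(2) by simp
    then have "(\<Union>\<alpha>\<in>I n. Delta_rect d X dst (R \<alpha>) (r n) (\<lambda>i. a i + t i)) \<subseteq>
        (\<Union>n\<in>{k..}. (\<Union>\<alpha>\<in>I n. Delta_rect d X dst (R \<alpha>) (r n) (\<lambda>i. a i + t i)))"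
      by (rule UN_upper)
    note Int_mono[OF subset_refl this]
    with \<eta> show ?thesis by (meson order_trans)
  qed
  with G(1-3,5) show "\<exists>G\<in>sets P. openin Prod.mtopology G \<and> 0 < measure P G \<and>
     (\<exists>\<eta>>0. \<forall>g\<in>G. Prod.mball g \<eta> \<subseteq> Prod.mball x \<xi> \<inter>
        (\<Union>n\<in>{k..}. \<Union>\<alpha>\<in>I n. Delta_rect d X dst (R \<alpha>) (r n) (\<lambda>i. a i + t i))) \<and>
     (\<forall>y\<in>XX. \<forall>s. 0 < s \<and> s \<le> min r\<^sub>0 1 / 2 \<longrightarrow>
        measure P (G \<inter> Prod.mball y s) \<le> K_upper / (\<theta> / 2 * K_lower) * s powr dim_no * measure P G / \<xi> powr sum \<delta> {..<d})"
    by (intro bexI[of _ G] conjI)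
qed

lemma (in rectangle_system) ex_compact_ball:
  assumes "\<And>i. i < d \<Longrightarrow> locally_compact_space (Metric_space.mtopology (X i) (dst i))"
    and "x \<in> XX"
  obtains s S where "0 < s" "compactin Prod.mtopology S" "Prod.mball x s \<subseteq> S"
proof -
  have "\<exists>s S. 0 < s \<and> compactin (Metric_space.mtopology (X i) (dst i)) S \<and> ball_i (X i) (dst i) (x i) s \<subseteq> S"
    if i: "i < d" for i
  proof -
    interpret Xi: Metric_space "X i" "dst i" by (rule metric[OF i])
    have xi: "x i \<in> X i" using assms(2) i by auto
    then obtain U S where U: "openin Xi.mtopology U" "compactin Xi.mtopology S" "x i \<in> U" "U \<subseteq> S"
      using assms(1)[OF i] unfolding locally_compact_space_def by auto
    then obtain s where "0 < s" "Xi.mball (x i) s \<subseteq> U" unfolding Xi.openin_mtopology by blast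
    moreover have "ball_i (X i) (dst i) (x i) s = Xi.mball (x i) s"
      unfolding ball_i_def Xi.mball_def using xi by simp
    ultimately show ?thesis using U by blast
  qed
  then obtain s S where sS: "\<And>i. i < d \<Longrightarrow> 0 < s i" "\<And>i. i < d \<Longrightarrow> compactin (Metric_space.mtopology (X i) (dst i)) (S i)"
      "\<And>i. i < d \<Longrightarrow> ball_i (X i) (dst i) (x i) (s i) \<subseteq> S i"
    by metis
  obtain q where q: "0 < q" "\<And>i. i < d \<Longrightarrow> q \<le> s i" using finite_common_radius[of d s] sS(1) by blast
  have "ball_X d X dst x q \<subseteq> PiE {..<d} S"
    unfolding ball_X_def
  proof (rule PiE_mono)
    fix i assume "i \<in> {..<d}"
    then have i: "i < d" by simp
    have "ball_i (X i) (dst i) (x i) q \<subseteq> ball_i (X i) (dst i) (x i) (s i)"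
      using q(2)[OF i] by (auto simp: ball_i_def)
    then show "ball_i (X i) (dst i) (x i) q \<subseteq> S i" using sS(3)[OF i] by blast
  qed
  then show ?thesis
    using that[OF q(1) compactin_prod_dist_PiE[OF d metric sS(2)]] ball_X_mball[OF assms(2)] by simp
qed

theorem mainTheorem1:
  fixes d :: nat
    and X :: "nat \<Rightarrow> 'a set"
    and dst :: "nat \<Rightarrow> 'a \<Rightarrow> 'a \<Rightarrow> real"
    and m :: "nat \<Rightarrow> 'a measure"
    and \<delta> :: "nat \<Rightarrow> real"
    and J :: "'j set"
    and \<beta> :: "'j \<Rightarrow> real"
    and l u :: "nat \<Rightarrow> real"
    and \<rho> :: "real \<Rightarrow> real"
    and R :: "'j \<Rightarrow> nat \<Rightarrow> 'a set"
    and \<kappa> :: real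
    and a t :: "nat \<Rightarrow> real"
  assumes d_pos: "d \<ge> 1"
    and metric: "\<And>i. i < d \<Longrightarrow> Metric_space (X i) (dst i)"
    and bounded: "\<And>i. i < d \<Longrightarrow> Metric_space.mbounded (X i) (dst i) (X i)"
    and loc_compact: "\<And>i. i < d \<Longrightarrow> locally_compact_space (Metric_space.mtopology (X i) (dst i))"
    and prob: "\<And>i. i < d \<Longrightarrow> prob_space (m i)"
    and space_m: "\<And>i. i < d \<Longrightarrow> space (m i) = X i"
    and borel_m: "\<And>i. i < d \<Longrightarrow>
         sets (m i) = sigma_sets (X i) {U. openin (Metric_space.mtopology (X i) (dst i)) U}"
    and \<delta>_pos: "\<And>i. i < d \<Longrightarrow> \<delta> i > 0"
    and ahlfors: "\<And>i. i < d \<Longrightarrow> ahlfors_regular (X i) (dst i) (m i) (\<delta> i)"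
    and J_countable: "countable J" and J_infinite: "infinite J"
    and \<beta>_pos: "\<And>\<alpha>. \<alpha> \<in> J \<Longrightarrow> \<beta> \<alpha> > 0"
    and \<beta>_finite: "\<And>M. M > 1 \<Longrightarrow> finite {\<alpha>\<in>J. \<beta> \<alpha> < M}"
    and l_mono: "incseq l" and u_mono: "incseq u"
    and l_le_u: "\<And>n. l n \<le> u n"
    and l_lim: "filterlim l at_top sequentially"
    and \<rho>_pos: "\<And>x. x > 0 \<Longrightarrow> \<rho> x > 0"
    and \<rho>_noninc: "\<And>x y. 0 < x \<Longrightarrow> x \<le> y \<Longrightarrow> \<rho> y \<le> \<rho> x"
    and \<rho>_lim: "(\<rho> \<longlongrightarrow> 0) at_top"
    and R_sub: "\<And>\<alpha> i. \<alpha> \<in> J \<Longrightarrow> i < d \<Longrightarrow> R \<alpha> i \<subseteq> X i"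
    and \<kappa>_range: "0 \<le> \<kappa>" "\<kappa> < 1"
    and scaling: "\<And>i. i < d \<Longrightarrow> kappa_scaling (X i) (dst i) (m i) (\<delta> i) J (\<lambda>\<alpha>. R \<alpha> i) \<kappa>"
    and a_pos: "\<And>i. i < d \<Longrightarrow> a i > 0"
    and ubiquity: "local_ubiquity_rect d X dst m J R \<beta> l u \<rho> a"
    and t_pos: "\<And>i. i < d \<Longrightarrow> t i > 0"
  shows "hausdorff_dim (prod_dist d dst) (W_set d X dst J R \<beta> \<rho> a t)
           \<ge> ereal (dim_number d \<delta> \<kappa> a t)"
proof -
  define reg where "reg i c C r0 \<longleftrightarrow> c > 0 \<and> C > 0 \<and> r0 > 0 \<and>
        (\<forall>x\<in>X i. \<forall>r. 0 < r \<and> r \<le> r0 \<longrightarrow>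
            c * r powr \<delta> i \<le> measure (m i) (ball_i (X i) (dst i) x r) \<and>
            measure (m i) (ball_i (X i) (dst i) x r) \<le> C * r powr \<delta> i)" for i c C r0
  define scal where "scal i c2 c3 r0 \<longleftrightarrow> c2 > 0 \<and> c3 > 0 \<and> r0 > 0 \<and>
        (\<forall>\<alpha>\<in>J. \<forall>x\<in>R \<alpha> i. \<forall>\<epsilon> r. 0 < \<epsilon> \<and> \<epsilon> < r \<and> r \<le> r0 \<longrightarrow>
            c2 * r powr (\<delta> i * \<kappa>) * \<epsilon> powr (\<delta> i * (1 - \<kappa>))
              \<le> measure (m i) (ball_i (X i) (dst i) x r \<inter> Delta (X i) (dst i) (R \<alpha> i) \<epsilon>) \<and>
            measure (m i) (ball_i (X i) (dst i) x r \<inter> Delta (X i) (dst i) (R \<alpha> i) \<epsilon>)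
              \<le> c3 * r powr (\<delta> i * \<kappa>) * \<epsilon> powr (\<delta> i * (1 - \<kappa>)))" for i c2 c3 r0
  have "\<exists>c C r0. reg i c C r0" if "i < d" for i
    using ahlfors[OF that] unfolding ahlfors_regular_def reg_def .
  then obtain c C q where reg: "\<And>i. i < d \<Longrightarrow> reg i (c i) (C i) (q i)" by metis
  have "\<exists>c2 c3 r0. scal i c2 c3 r0" if "i < d" for i
    using scaling[OF that] unfolding kappa_scaling_def scal_def .
  then obtain c2 c3 q' where scal: "\<And>i. i < d \<Longrightarrow> scal i (c2 i) (c3 i) (q' i)" by metis
  have "0 < min (q i) (q' i)" if "i < d" for i
    using reg[OF that] scal[OF that] by (simp add: reg_def scal_def)
  then obtain r0 where r0: "0 < r0" "\<And>i. i < d \<Longrightarrow> r0 \<le> min (q i) (q' i)"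
    using finite_common_radius[of d "\<lambda>i. min (q i) (q' i)"] by blast
  interpret rectangle_system d X dst m J R \<delta> c C c2 c3 a t \<kappa> r0
  proof (rule rectangle_system.intro)
    show "1 \<le> d" by (rule d_pos)
    show "0 < a i" "0 < t i" if "i < d" for i using a_pos t_pos that by auto
    fix i assume i: "i < d"
    show "resonant_space (X i) (dst i) (m i) J (\<lambda>\<alpha>. R \<alpha> i) (\<delta> i) \<kappa> (c i) (C i) (c2 i) (c3 i) r0"
    proof (intro resonant_space.intro resonant_space_axioms.intro)
      show "Metric_space (X i) (dst i)" by (rule metric[OF i])
      show "prob_space (m i)" by (rule prob[OF i])
      show "U \<in> sets (m i)" if "openin (Metric_space.mtopology (X i) (dst i)) U" for U
        unfolding borel_m[OF i] using that by (intro sigma_sets.Basic) simp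
      show "R \<alpha> i \<subseteq> X i" if "\<alpha> \<in> J" for \<alpha> by (rule R_sub[OF that i])
      show "0 < \<delta> i" by (rule \<delta>_pos[OF i])
      show "0 \<le> \<kappa>" "\<kappa> < 1" by (rule \<kappa>_range)+
      show "0 < c i" "0 < C i" "0 < c2 i" "0 < c3 i" "0 < r0"
        using reg[OF i] scal[OF i] r0 by (auto simp: reg_def scal_def)
      show "c i * r powr \<delta> i \<le> measure (m i) (ball_i (X i) (dst i) x r)"
        "measure (m i) (ball_i (X i) (dst i) x r) \<le> C i * r powr \<delta> i"
        if "x \<in> X i" "0 < r" "r \<le> r0" for x r
        using reg[OF i] r0(2)[OF i] that unfolding reg_def by auto
      show "c2 i * r powr (\<delta> i * \<kappa>) * \<epsilon> powr (\<delta> i * (1 - \<kappa>))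
          \<le> measure (m i) (ball_i (X i) (dst i) x r \<inter> Delta (X i) (dst i) (R \<alpha> i) \<epsilon>)"
        "measure (m i) (ball_i (X i) (dst i) x r \<inter> Delta (X i) (dst i) (R \<alpha> i) \<epsilon>)
          \<le> c3 i * r powr (\<delta> i * \<kappa>) * \<epsilon> powr (\<delta> i * (1 - \<kappa>))"
        if "\<alpha> \<in> J" "x \<in> R \<alpha> i" "0 < \<epsilon>" "\<epsilon> < r" "r \<le> r0" for \<alpha> x \<epsilon> r
        using scal[OF i] r0(2)[OF i] that unfolding scal_def by auto
    qed
  qed
  obtain \<theta> where \<theta>: "0 < \<theta>" "\<And>x s. x \<in> XX \<Longrightarrow> 0 < s \<Longrightarrow>
      limsup (\<lambda>n. ereal (measure P (ball_X d X dst x s \<inter> (\<Union>\<alpha>\<in>J_n J \<beta> l u n. Delta_rect d X dst (R \<alpha>) (\<rho> (u n)) a))))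
        \<ge> ereal (\<theta> * measure P (ball_X d X dst x s))"
    using ubiquity unfolding local_ubiquity_rect_def by blast
  have u_lim: "filterlim u at_top sequentially"
    using l_lim by (rule filterlim_at_top_mono) (simp add: l_le_u)
  define T where "T k = (\<Union>n\<in>{k..}. \<Union>\<alpha>\<in>J_n J \<beta> l u n. Delta_rect d X dst (R \<alpha>) (\<rho> (u n)) (\<lambda>i. a i + t i))" for k
  interpret ahlfors_transfer XX "prod_dist d dst" P T "sum \<delta> {..<d}" dim_no
    "\<Prod>i<d. c i" "\<Prod>i<d. C i" "K_upper / (\<theta> / 2 * K_lower)" "min r0 1 / 2"
    unfolding T_def
  proof (rule ahlfors_transfer_rectangles[OF _ _ _ \<theta>])
    show "J_n J \<beta> l u n \<subseteq> J" for n by (auto simp: J_n_def)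
    have "\<forall>\<^sub>F n in sequentially. 0 < u n" using u_lim by (simp add: filterlim_at_top_dense)
    then show "\<forall>\<^sub>F n in sequentially. 0 < \<rho> (u n)" by eventually_elim (rule \<rho>_pos)
    show "(\<lambda>n. \<rho> (u n)) \<longlonglongrightarrow> 0" by (rule filterlim_compose[OF \<rho>_lim u_lim])
  qed
  \<comment> \<open>The starting ball needs a centre; a space of total mass 1 has a point.\<close>
  have "X i \<noteq> {}" if "i < d" for i
    using prob_space.not_empty[OF prob[OF that]] space_m[OF that] by simp
  then have "XX \<noteq> {}" by (auto simp: PiE_eq_empty_iff)
  then obtain x0 where x0: "x0 \<in> XX" by blast
  obtain s S where S: "0 < s" "compactin Prod.mtopology S" "Prod.mball x0 s \<subseteq> S"
    using ex_compact_ball[OF loc_compact x0] by blast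
  have "XX \<inter> (\<Inter>k. T k) \<subseteq> W_set d X dst J R \<beta> \<rho> a t"
  proof
    fix x assume x: "x \<in> XX \<inter> (\<Inter>k. T k)"
    define F where "F = {\<alpha>\<in>J. x \<in> Delta_rect d X dst (R \<alpha>) (\<rho> (\<beta> \<alpha>)) (\<lambda>i. a i + t i)}"
    \<comment> \<open>Membership in every \<open>T k\<close> gives infinitely many levels, and one
      index might serve several of them. Since \<open>\<beta> \<alpha>\<close> is at least
      \<open>l n\<close> at level \<open>n\<close> and \<open>l\<close> tends to infinity, finitely
      many indices cannot serve arbitrarily late levels.\<close>
    have "infinite F"
    proof
      assume fin: "finite F"
      define b where "b = Max (insert 0 (\<beta> ` F))"
      have b: "\<beta> \<alpha> \<le> b" if "\<alpha> \<in> F" for \<alpha> unfolding b_def using fin that by auto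
      have "\<forall>\<^sub>F n in sequentially. b < l n" using l_lim by (simp add: filterlim_at_top_dense)
      then obtain k where k: "\<And>n. k \<le> n \<Longrightarrow> b < l n" by (auto simp: eventually_sequentially)
      obtain n \<alpha> where n: "k \<le> n" "\<alpha> \<in> J" "l n \<le> \<beta> \<alpha>" "\<beta> \<alpha> \<le> u n"
          and xD: "x \<in> Delta_rect d X dst (R \<alpha>) (\<rho> (u n)) (\<lambda>i. a i + t i)"
        using x unfolding T_def J_n_def by blast
      \<comment> \<open>The construction works with \<open>\<rho> (u n)\<close>, the smallest rate
        on the level, so its neighbourhoods lie inside those defining the limsup set.\<close>
      have \<rho>: "0 < \<rho> (u n)" "\<rho> (u n) \<le> \<rho> (\<beta> \<alpha>)"
        using \<beta>_pos[OF n(2)] n(4) by (auto intro!: \<rho>_pos \<rho>_noninc)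
      have "Delta_rect d X dst (R \<alpha>) (\<rho> (u n)) (\<lambda>i. a i + t i) \<subseteq> Delta_rect d X dst (R \<alpha>) (\<rho> (\<beta> \<alpha>)) (\<lambda>i. a i + t i)"
        unfolding Delta_rect_def
      proof (rule PiE_mono)
        fix i assume "i \<in> {..<d}"
        then have "0 \<le> a i + t i" using a_pos[of i] t_pos[of i] by simp
        then have "\<rho> (u n) powr (a i + t i) \<le> \<rho> (\<beta> \<alpha>) powr (a i + t i)"
          using \<rho> by (intro powr_mono2) auto
        then show "Delta (X i) (dst i) (R \<alpha> i) (\<rho> (u n) powr (a i + t i))
            \<subseteq> Delta (X i) (dst i) (R \<alpha> i) (\<rho> (\<beta> \<alpha>) powr (a i + t i))"
          unfolding Delta_eq by (auto intro: less_le_trans)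
      qed
      with xD n(2) have "\<alpha> \<in> F" unfolding F_def by blast
      from b[OF this] k[OF n(1)] n(3) show False by simp
    qed
    with x show "x \<in> W_set d X dst J R \<beta> \<rho> a t" by (simp add: W_set_def F_def)
  qed
  from hausdorff_dim_ge[OF x0 S this] show ?thesis .
qed

end
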